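(* When $\mathcal{C}$ is a wellpowered and complete category, then the forgetful functor $$\mathsf{Top}(\mathcal{C}) \to \mathcal{C}$$ is topological. Hence, if $\mathcal{C}$ is also cocomplete, $\mathsf{Top}(\mathcal{C})$ is cocomplete as well.
   Context: Conventions: categories are locally small; limits and colimits are small. A functor $U:\mathcal{A}\to\mathcal{C}$ is topological if it is faithful and every (possibly large) $U$-structured family $\{f_i:X\to U(S_i)\}_{i\in I}$ has an initial lift: an object $A$ with $U(A)=X$ such that each $f_i$ lifts to a morphism $A\to S_i$, and a morphism $U(B)\to X$ lifts to $B\to A$ if and only if each composite $U(B)\to X\to U(S_i)$ lifts to $B\to S_i$. Directed sets are non-empty preordered sets in which any two elements have an upper bound. $P_{\ge p}:=\{q\in P:q\ge p\}$. A map $h:Q\to P$ of directed sets (not necessarily monotonic) is cofinal if for every $p\in P$ there is $q\in Q$ with $h(Q_{\ge q})\subseteq P_{\ge p}$. A subset $Q\subseteq P$ is cofinal if every $p\in P$ has some $q\in Q$ with $q\ge p$. Products of directed sets carry the componentwise order. For a map $h:Q\to P$, $X^h:X^P\to X^Q$ is defined by $\mathrm{pr}_q\circ X^h=\mathrm{pr}_{h(q)}$. Let $\mathcal{C}$ be complete. A topology (net convergence relation) on $X\in\mathcal{C}$ is a family of monomorphisms $\iota_P:C(P,X)\hookrightarrow X^P\times X$, one for each directed set $P$, such that: (1) (Constant nets) for every $P$ the diagonal $X\to X^P\times X$ factors through $\iota_P$. (2) (Subnets) for every cofinal map $h:Q\to P$ the morphism $(X^h\times\mathrm{id}_X)\circ\iota_P$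 factors through $\iota_Q$. (3) (Locality) for every directed set $P$ and every family of cofinal maps $h_Q:R_Q\to Q$ (with $R_Q$ directed), one for each cofinal subset $Q\subseteq P$, let $F$ be the fiber product of $\prod_Q C(R_Q,X)$ and $X^P\times X$ over $\prod_Q (X^{R_Q}\times X)$, with respect to $\prod_Q\iota_{R_Q}$ and the morphism with components $X^{R_Q\to Q\subseteq P}\times\mathrm{id}_X$; then the projection $F\to X^P\times X$ factors through $\iota_P$. (4) (Iterations) for every directed set $P$ and every family $(Q_p)_{p\in P}$ of directed sets, let $G=\bigl(\prod_{p\in P}C(Q_p,X)\bigr)\times_{X^P}C(P,X)$, where the first morphism to $X^P$ has components $C(Q_p,X)\to X^{Q_p}\times X\to X$ and the second is $C(P,X)\to X^P\times X\to X^P$; then the morphism $G\to X^{P\times\prod_pQ_p}\times X$ whose $(p,f)$-component is $G\to C(Q_p,X)\to X^{Q_p}\xrightarrow{\mathrm{pr}_{f(p)}}X$ and whose last component is $G\to C(P,X)\to X$ factors through $\iota_{P\times\prod_pQ_p}$. $\mathsf{Top}(\mathcal{C})$ is the category of pairs $(X,C)$ of an object $X\in\mathcal{C}$ with a topology $C$ (net-based topological space objects); a morphism $(X,C)\to(Y,D)$ is a morphism $f:X\to Y$ in $\mathcal{C}$ such that for every directed set $P$ the composite $C(P,X)\to X^P\times X\xrightarrow{f^P\times f}Y^P\times Y$ factors through $D(P,Y)\hookrightarrow Y^P\times Y$. The forgetful functor is $(X,C)\mapsto X$. *)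

theory Defs
  imports "HOL-Library.Equipollence"
begin

section \<open>Smallness\<close>

text \<open>
  Sizes are measured by a type \<open>'u\<close>: a set, of whatever type, is small if its cardinality is less
  than that of \<open>'u\<close>. The type \<open>'u\<close> is a universe if small sets are closed under power sets and
  under unions of small families, that is, if the cardinality of \<open>'u\<close> is a regular strong limit
  cardinal. For an uncountable \<open>'u\<close> this is a Grothendieck universe; for a countable one, small
  means finite. Nothing is assumed about the sizes of sets that are not required to be small.
\<close>

definition small :: "'u itself \<Rightarrow> 'b set \<Rightarrow> bool" where
  "small _ A \<longleftrightarrow> A \<prec> (UNIV :: 'u set)"

definition universe :: "'u itself \<Rightarrow> bool" where
  "universe u \<longleftrightarrow>
     infinite (UNIV :: 'u set) \<and>
     (\<forall>A :: 'u set. small u A \<longrightarrow> small u (Pow A)) \<and>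
     (\<forall>\<A> :: 'u set set. small u \<A> \<and> (\<forall>A\<in>\<A>. small u A) \<longrightarrow> small u (\<Union>\<A>))"


section \<open>Categories and functors\<close>

record ('o, 'a) cat =
  Obj :: "'o set"
  Arr :: "'a set"
  Dom :: "'a \<Rightarrow> 'o"
  Cod :: "'a \<Rightarrow> 'o"
  Id :: "'o \<Rightarrow> 'a"
  Comp :: "'a \<Rightarrow> 'a \<Rightarrow> 'a" (infixr \<open>\<cdot>\<index>\<close> 70)

definition hom :: "('o, 'a) cat \<Rightarrow> 'o \<Rightarrow> 'o \<Rightarrow> 'a set" where
  "hom C A B = {f \<in> Arr C. Dom C f = A \<and> Cod C f = B}"

locale category =
  fixes C :: "('o, 'a) cat" (structure)
  assumes dom_obj: "f \<in> Arr C \<Longrightarrow> Dom C f \<in> Obj C"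
    and cod_obj: "f \<in> Arr C \<Longrightarrow> Cod C f \<in> Obj C"
    and id_hom: "A \<in> Obj C \<Longrightarrow> Id C A \<in> hom C A A"
    and comp_hom: "f \<in> hom C A B \<Longrightarrow> g \<in> hom C B D \<Longrightarrow> g \<cdot> f \<in> hom C A D"
    and comp_id_left: "f \<in> hom C A B \<Longrightarrow> Id C B \<cdot> f = f"
    and comp_id_right: "f \<in> hom C A B \<Longrightarrow> f \<cdot> Id C A = f"
    and comp_assoc:
      "f \<in> hom C A B \<Longrightarrow> g \<in> hom C B D \<Longrightarrow> h \<in> hom C D E \<Longrightarrow> (h \<cdot> g) \<cdot> f = h \<cdot> (g \<cdot> f)"

definition locally_small :: "'u itself \<Rightarrow> ('o, 'a) cat \<Rightarrow> bool" where
  "locally_small u C \<longleftrightarrow> (\<forall>A\<in>Obj C. \<forall>B\<in>Obj C. small u (hom C A B))"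

record ('o1, 'a1, 'o2, 'a2) cat_map =
  on_obj :: "'o1 \<Rightarrow> 'o2"
  on_arr :: "'a1 \<Rightarrow> 'a2"

locale cat_functor = A: category A + B: category B
  for A :: "('o1, 'a1) cat" and B :: "('o2, 'a2) cat" +
  fixes F :: "('o1, 'a1, 'o2, 'a2) cat_map"
  assumes on_obj: "X \<in> Obj A \<Longrightarrow> on_obj F X \<in> Obj B"
    and on_arr: "f \<in> hom A X Y \<Longrightarrow> on_arr F f \<in> hom B (on_obj F X) (on_obj F Y)"
    and on_id: "X \<in> Obj A \<Longrightarrow> on_arr F (Id A X) = Id B (on_obj F X)"
    and on_comp: "f \<in> hom A X Y \<Longrightarrow> g \<in> hom A Y Z \<Longrightarrow>
      on_arr F (g \<cdot>\<^bsub>A\<^esub> f) = on_arr F g \<cdot>\<^bsub>B\<^esub> on_arr F f"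

definition faithful ::
  "('o1, 'a1) cat \<Rightarrow> ('o1, 'a1, 'o2, 'a2) cat_map \<Rightarrow> bool" where
  "faithful A F \<longleftrightarrow>
     (\<forall>X\<in>Obj A. \<forall>Y\<in>Obj A. inj_on (on_arr F) (hom A X Y))"


section \<open>Limits and colimits\<close>

definition is_cone ::
  "('j, 'b) cat \<Rightarrow> ('o, 'a) cat \<Rightarrow> ('j, 'b, 'o, 'a) cat_map \<Rightarrow> 'o \<Rightarrow> ('j \<Rightarrow> 'a) \<Rightarrow> bool" where
  "is_cone J C D L p \<longleftrightarrow>
     L \<in> Obj C \<and>
     (\<forall>j\<in>Obj J. p j \<in> hom C L (on_obj D j)) \<and>
     (\<forall>u\<in>Arr J. on_arr D u \<cdot>\<^bsub>C\<^esub> p (Dom J u) = p (Cod J u))"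

definition is_limit ::
  "('j, 'b) cat \<Rightarrow> ('o, 'a) cat \<Rightarrow> ('j, 'b, 'o, 'a) cat_map \<Rightarrow> 'o \<Rightarrow> ('j \<Rightarrow> 'a) \<Rightarrow> bool" where
  "is_limit J C D L p \<longleftrightarrow>
     is_cone J C D L p \<and>
     (\<forall>Z q. is_cone J C D Z q \<longrightarrow>
       (\<exists>!h. h \<in> hom C Z L \<and> (\<forall>j\<in>Obj J. p j \<cdot>\<^bsub>C\<^esub> h = q j)))"

definition is_cocone ::
  "('j, 'b) cat \<Rightarrow> ('o, 'a) cat \<Rightarrow> ('j, 'b, 'o, 'a) cat_map \<Rightarrow> 'o \<Rightarrow> ('j \<Rightarrow> 'a) \<Rightarrow> bool" where
  "is_cocone J C D L i \<longleftrightarrow>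
     L \<in> Obj C \<and>
     (\<forall>j\<in>Obj J. i j \<in> hom C (on_obj D j) L) \<and>
     (\<forall>u\<in>Arr J. i (Cod J u) \<cdot>\<^bsub>C\<^esub> on_arr D u = i (Dom J u))"

definition is_colimit ::
  "('j, 'b) cat \<Rightarrow> ('o, 'a) cat \<Rightarrow> ('j, 'b, 'o, 'a) cat_map \<Rightarrow> 'o \<Rightarrow> ('j \<Rightarrow> 'a) \<Rightarrow> bool" where
  "is_colimit J C D L i \<longleftrightarrow>
     is_cocone J C D L i \<and>
     (\<forall>Z q. is_cocone J C D Z q \<longrightarrow>
       (\<exists>!h. h \<in> hom C L Z \<and> (\<forall>j\<in>Obj J. h \<cdot>\<^bsub>C\<^esub> i j = q j)))"

text \<open>
  Up to isomorphism every small category has its objects and arrows in \<open>'u\<close>, so small diagrams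
  may be indexed by such categories.
\<close>

definition complete_cat :: "'u itself \<Rightarrow> ('o, 'a) cat \<Rightarrow> bool" where
  "complete_cat u C \<longleftrightarrow>
     (\<forall>(J :: ('u, 'u) cat) D.
        small u (Obj J) \<and> small u (Arr J) \<and> cat_functor J C D \<longrightarrow> (\<exists>L p. is_limit J C D L p))"

definition cocomplete_cat :: "'u itself \<Rightarrow> ('o, 'a) cat \<Rightarrow> bool" where
  "cocomplete_cat u C \<longleftrightarrow>
     (\<forall>(J :: ('u, 'u) cat) D.
        small u (Obj J) \<and> small u (Arr J) \<and> cat_functor J C D \<longrightarrow> (\<exists>L i. is_colimit J C D L i))"


section \<open>Monomorphisms and subobjects\<close>

definition mono_arr :: "('o, 'a) cat \<Rightarrow> 'a \<Rightarrow> bool" where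
  "mono_arr C m \<longleftrightarrow>
     m \<in> Arr C \<and>
     (\<forall>Z\<in>Obj C. \<forall>g\<in>hom C Z (Dom C m). \<forall>h\<in>hom C Z (Dom C m). m \<cdot>\<^bsub>C\<^esub> g = m \<cdot>\<^bsub>C\<^esub> h \<longrightarrow> g = h)"

definition factors_through :: "('o, 'a) cat \<Rightarrow> 'a \<Rightarrow> 'a \<Rightarrow> bool" where
  "factors_through C f m \<longleftrightarrow> (\<exists>h\<in>hom C (Dom C f) (Dom C m). m \<cdot>\<^bsub>C\<^esub> h = f)"

definition monos_into :: "('o, 'a) cat \<Rightarrow> 'o \<Rightarrow> 'a set" where
  "monos_into C X = {m. mono_arr C m \<and> Cod C m = X}"

definition subobject_rel :: "('o, 'a) cat \<Rightarrow> 'o \<Rightarrow> 'a rel" where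
  "subobject_rel C X =
     {(m, n) \<in> monos_into C X \<times> monos_into C X. factors_through C m n \<and> factors_through C n m}"

definition wellpowered :: "'u itself \<Rightarrow> ('o, 'a) cat \<Rightarrow> bool" where
  "wellpowered u C \<longleftrightarrow> (\<forall>X\<in>Obj C. small u (monos_into C X // subobject_rel C X))"


section \<open>Products and fiber products\<close>

definition is_product ::
  "('o, 'a) cat \<Rightarrow> 'i set \<Rightarrow> ('i \<Rightarrow> 'o) \<Rightarrow> 'o \<Rightarrow> ('i \<Rightarrow> 'a) \<Rightarrow> bool" where
  "is_product C I F L p \<longleftrightarrow>
     L \<in> Obj C \<and> (\<forall>i\<in>I. p i \<in> hom C L (F i)) \<and>
     (\<forall>Z\<in>Obj C. \<forall>q. (\<forall>i\<in>I. q i \<in> hom C Z (F i)) \<longrightarrow>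
       (\<exists>!h. h \<in> hom C Z L \<and> (\<forall>i\<in>I. p i \<cdot>\<^bsub>C\<^esub> h = q i)))"

text \<open>Products are chosen once and for all; the choice is meaningful whenever a product exists.\<close>

definition product_cone :: "('o, 'a) cat \<Rightarrow> 'i set \<Rightarrow> ('i \<Rightarrow> 'o) \<Rightarrow> 'o \<times> ('i \<Rightarrow> 'a)" where
  "product_cone C I F = (SOME Lp. is_product C I F (fst Lp) (snd Lp))"

definition product_obj :: "('o, 'a) cat \<Rightarrow> 'i set \<Rightarrow> ('i \<Rightarrow> 'o) \<Rightarrow> 'o" where
  "product_obj C I F = fst (product_cone C I F)"

definition pr :: "('o, 'a) cat \<Rightarrow> 'i set \<Rightarrow> ('i \<Rightarrow> 'o) \<Rightarrow> 'i \<Rightarrow> 'a" where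
  "pr C I F = snd (product_cone C I F)"

definition tuple :: "('o, 'a) cat \<Rightarrow> 'i set \<Rightarrow> ('i \<Rightarrow> 'o) \<Rightarrow> 'o \<Rightarrow> ('i \<Rightarrow> 'a) \<Rightarrow> 'a" where
  "tuple C I F Z q =
     (THE h. h \<in> hom C Z (product_obj C I F) \<and> (\<forall>i\<in>I. pr C I F i \<cdot>\<^bsub>C\<^esub> h = q i))"

definition product_map ::
  "('o, 'a) cat \<Rightarrow> 'i set \<Rightarrow> ('i \<Rightarrow> 'o) \<Rightarrow> ('i \<Rightarrow> 'o) \<Rightarrow> ('i \<Rightarrow> 'a) \<Rightarrow> 'a" where
  "product_map C I F G f = tuple C I G (product_obj C I F) (\<lambda>i. f i \<cdot>\<^bsub>C\<^esub> pr C I F i)"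

definition bin_product :: "('o, 'a) cat \<Rightarrow> 'o \<Rightarrow> 'o \<Rightarrow> 'o" where
  "bin_product C A B = product_obj C UNIV (case_bool A B)"

definition pr1 :: "('o, 'a) cat \<Rightarrow> 'o \<Rightarrow> 'o \<Rightarrow> 'a" where
  "pr1 C A B = pr C UNIV (case_bool A B) True"

definition pr2 :: "('o, 'a) cat \<Rightarrow> 'o \<Rightarrow> 'o \<Rightarrow> 'a" where
  "pr2 C A B = pr C UNIV (case_bool A B) False"

definition pair :: "('o, 'a) cat \<Rightarrow> 'o \<Rightarrow> 'o \<Rightarrow> 'o \<Rightarrow> 'a \<Rightarrow> 'a \<Rightarrow> 'a" where
  "pair C A B Z f g = tuple C UNIV (case_bool A B) Z (case_bool f g)"

definition times_map ::
  "('o, 'a) cat \<Rightarrow> 'a \<Rightarrow> 'a \<Rightarrow> 'a" where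
  "times_map C f g =
     (let A = Dom C f; B = Dom C g
      in pair C (Cod C f) (Cod C g) (bin_product C A B) (f \<cdot>\<^bsub>C\<^esub> pr1 C A B) (g \<cdot>\<^bsub>C\<^esub> pr2 C A B))"

definition is_pullback ::
  "('o, 'a) cat \<Rightarrow> 'a \<Rightarrow> 'a \<Rightarrow> 'o \<Rightarrow> 'a \<Rightarrow> 'a \<Rightarrow> bool" where
  "is_pullback C f g L p q \<longleftrightarrow>
     p \<in> hom C L (Dom C f) \<and> q \<in> hom C L (Dom C g) \<and> f \<cdot>\<^bsub>C\<^esub> p = g \<cdot>\<^bsub>C\<^esub> q \<and>
     (\<forall>Z\<in>Obj C. \<forall>r\<in>hom C Z (Dom C f). \<forall>s\<in>hom C Z (Dom C g). f \<cdot>\<^bsub>C\<^esub> r = g \<cdot>\<^bsub>C\<^esub> s \<longrightarrow>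
       (\<exists>!h. h \<in> hom C Z L \<and> p \<cdot>\<^bsub>C\<^esub> h = r \<and> q \<cdot>\<^bsub>C\<^esub> h = s))"


section \<open>Directed sets\<close>

text \<open>
  A directed set is given by its preorder \<open>P\<close>, with \<open>(p, q) \<in> P\<close> meaning \<open>p \<le> q\<close>; by reflexivity
  the underlying set is \<open>Field P\<close>, and \<open>above P p\<close> is the set of all \<open>q \<ge> p\<close>.
\<close>

definition directed :: "'b rel \<Rightarrow> bool" where
  "directed P \<longleftrightarrow>
     Preorder P \<and> Field P \<noteq> {} \<and>
     (\<forall>p\<in>Field P. \<forall>q\<in>Field P. \<exists>r\<in>Field P. (p, r) \<in> P \<and> (q, r) \<in> P)"

text \<open>The small directed sets, up to isomorphism.\<close>

definition dirsets :: "'u rel set" where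
  "dirsets = {P. directed P \<and> small TYPE('u) (Field P)}"

definition cofinal_map :: "'b rel \<Rightarrow> 'c rel \<Rightarrow> ('b \<Rightarrow> 'c) \<Rightarrow> bool" where
  "cofinal_map Q P h \<longleftrightarrow>
     h ` Field Q \<subseteq> Field P \<and> (\<forall>p\<in>Field P. \<exists>q\<in>Field Q. h ` above Q q \<subseteq> above P p)"

definition cofinal_subsets :: "'b rel \<Rightarrow> 'b set set" where
  "cofinal_subsets P = {Q. Q \<subseteq> Field P \<and> (\<forall>p\<in>Field P. \<exists>q\<in>Q. (p, q) \<in> P)}"

definition iteration_order :: "'b rel \<Rightarrow> ('b \<Rightarrow> 'c rel) \<Rightarrow> ('b \<times> ('b \<Rightarrow> 'c)) rel" where
  "iteration_order P Q =
     (let S = Field P \<times> (\<Pi>\<^sub>E p\<in>Field P. Field (Q p))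
      in {(x, y) \<in> S \<times> S. (fst x, fst y) \<in> P \<and> (\<forall>p\<in>Field P. (snd x p, snd y p) \<in> Q p)})"

definition order_iso :: "'b rel \<Rightarrow> 'c rel \<Rightarrow> ('b \<Rightarrow> 'c) \<Rightarrow> bool" where
  "order_iso R S e \<longleftrightarrow>
     bij_betw e (Field R) (Field S) \<and>
     (\<forall>x\<in>Field R. \<forall>y\<in>Field R. (x, y) \<in> R \<longleftrightarrow> (e x, e y) \<in> S)"


section \<open>Net-based topologies\<close>

definition power_obj :: "('o, 'a) cat \<Rightarrow> 'o \<Rightarrow> 'b rel \<Rightarrow> 'o" where
  "power_obj C X P = product_obj C (Field P) (\<lambda>_. X)"

definition proj_at :: "('o, 'a) cat \<Rightarrow> 'o \<Rightarrow> 'b rel \<Rightarrow> 'b \<Rightarrow> 'a" where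
  "proj_at C X P = pr C (Field P) (\<lambda>_. X)"

text \<open>
  The morphism \<open>X\<^sup>h\<close> from \<open>X\<^sup>P\<close> to \<open>X\<^sup>Q\<close> for \<open>h : Q \<rightarrow> P\<close>, and the morphism \<open>f\<^sup>P\<close> from \<open>X\<^sup>P\<close>
  to \<open>Y\<^sup>P\<close> for \<open>f : X \<rightarrow> Y\<close>.
\<close>

definition reindex :: "('o, 'a) cat \<Rightarrow> 'o \<Rightarrow> 'b rel \<Rightarrow> 'c rel \<Rightarrow> ('c \<Rightarrow> 'b) \<Rightarrow> 'a" where
  "reindex C X P Q h = tuple C (Field Q) (\<lambda>_. X) (power_obj C X P) (\<lambda>q. proj_at C X P (h q))"

definition power_map :: "('o, 'a) cat \<Rightarrow> 'b rel \<Rightarrow> 'a \<Rightarrow> 'a" where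
  "power_map C P f = product_map C (Field P) (\<lambda>_. Dom C f) (\<lambda>_. Cod C f) (\<lambda>_. f)"

text \<open>The object \<open>X\<^sup>P \<times> X\<close>.\<close>

definition netlim :: "('o, 'a) cat \<Rightarrow> 'o \<Rightarrow> 'b rel \<Rightarrow> 'o" where
  "netlim C X P = bin_product C (power_obj C X P) X"

text \<open>
  A topology \<open>T\<close> on \<open>X\<close> assigns to a directed set \<open>P\<close> the monomorphism \<open>\<iota>\<^sub>P = T P\<close>, so that
  \<open>C(P, X) = Dom C (T P)\<close>. The composites of \<open>\<iota>\<^sub>P\<close> with the projections to \<open>X\<^sup>P\<close> and \<open>X\<close> are:
\<close>

definition net_of :: "('o, 'a) cat \<Rightarrow> 'o \<Rightarrow> ('b rel \<Rightarrow> 'a) \<Rightarrow> 'b rel \<Rightarrow> 'a" where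
  "net_of C X T P = pr1 C (power_obj C X P) X \<cdot>\<^bsub>C\<^esub> T P"

definition lim_of :: "('o, 'a) cat \<Rightarrow> 'o \<Rightarrow> ('b rel \<Rightarrow> 'a) \<Rightarrow> 'b rel \<Rightarrow> 'a" where
  "lim_of C X T P = pr2 C (power_obj C X P) X \<cdot>\<^bsub>C\<^esub> T P"

definition constant_nets :: "('o, 'a) cat \<Rightarrow> 'o \<Rightarrow> ('u rel \<Rightarrow> 'a) \<Rightarrow> bool" where
  "constant_nets C X T \<longleftrightarrow>
     (\<forall>P\<in>dirsets.
        factors_through C
          (pair C (power_obj C X P) X X (tuple C (Field P) (\<lambda>_. X) X (\<lambda>_. Id C X)) (Id C X))
          (T P))"

definition subnets :: "('o, 'a) cat \<Rightarrow> 'o \<Rightarrow> ('u rel \<Rightarrow> 'a) \<Rightarrow> bool" where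
  "subnets C X T \<longleftrightarrow>
     (\<forall>P\<in>dirsets. \<forall>Q\<in>dirsets. \<forall>h. cofinal_map Q P h \<longrightarrow>
        factors_through C (times_map C (reindex C X P Q h) (Id C X) \<cdot>\<^bsub>C\<^esub> T P) (T Q))"

definition locality :: "('o, 'a) cat \<Rightarrow> 'o \<Rightarrow> ('u rel \<Rightarrow> 'a) \<Rightarrow> bool" where
  "locality C X T \<longleftrightarrow>
     (\<forall>P\<in>dirsets. \<forall>R h.
        (\<forall>Q\<in>cofinal_subsets P. R Q \<in> dirsets \<and> cofinal_map (R Q) (Restr P Q) (h Q)) \<longrightarrow>
        (\<forall>F s t.
           is_pullback C
             (product_map C (cofinal_subsets P)
               (\<lambda>Q. Dom C (T (R Q))) (\<lambda>Q. netlim C X (R Q)) (\<lambda>Q. T (R Q)))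
             (tuple C (cofinal_subsets P) (\<lambda>Q. netlim C X (R Q)) (netlim C X P)
               (\<lambda>Q. times_map C (reindex C X P (R Q) (h Q)) (Id C X)))
             F s t \<longrightarrow>
           factors_through C t (T P)))"

text \<open>
  The product of \<open>P\<close> and the \<open>Q p\<close> does not have its elements in \<open>'u\<close>. It is replaced by an
  arbitrary isomorphic copy \<open>R\<close>, along \<open>e\<close>; see \<open>ex_iteration_copy\<close> below for the existence of \<open>R\<close>.
\<close>

definition iterations :: "('o, 'a) cat \<Rightarrow> 'o \<Rightarrow> ('u rel \<Rightarrow> 'a) \<Rightarrow> bool" where
  "iterations C X T \<longleftrightarrow>
     (\<forall>P\<in>dirsets. \<forall>Q. (\<forall>p\<in>Field P. Q p \<in> dirsets) \<longrightarrow>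
        (\<forall>R\<in>dirsets. \<forall>e. order_iso R (iteration_order P Q) e \<longrightarrow>
           (\<forall>G s t.
              is_pullback C
                (product_map C (Field P)
                  (\<lambda>p. Dom C (T (Q p))) (\<lambda>_. X) (\<lambda>p. lim_of C X T (Q p)))
                (net_of C X T P)
                G s t \<longrightarrow>
              factors_through C
                (pair C (power_obj C X R) X G
                  (tuple C (Field R) (\<lambda>_. X) G
                    (\<lambda>r. let (p, f) = e r in
                       proj_at C X (Q p) (f p) \<cdot>\<^bsub>C\<^esub> net_of C X T (Q p) \<cdot>\<^bsub>C\<^esub>
                         pr C (Field P) (\<lambda>p. Dom C (T (Q p))) p \<cdot>\<^bsub>C\<^esub> s))
                  (lim_of C X T P \<cdot>\<^bsub>C\<^esub> t))
                (T R))))"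

text \<open>Extensionality makes a topology the same thing as a family indexed by the directed sets only.\<close>

definition net_topology :: "('o, 'a) cat \<Rightarrow> 'o \<Rightarrow> ('u rel \<Rightarrow> 'a) \<Rightarrow> bool" where
  "net_topology C X T \<longleftrightarrow>
     T \<in> extensional dirsets \<and>
     (\<forall>P\<in>dirsets. mono_arr C (T P) \<and> Cod C (T P) = netlim C X P) \<and>
     constant_nets C X T \<and> subnets C X T \<and> locality C X T \<and> iterations C X T"

definition top_objects :: "('o, 'a) cat \<Rightarrow> ('o \<times> ('u rel \<Rightarrow> 'a)) set" where
  "top_objects C = {(X, T). X \<in> Obj C \<and> net_topology C X T}"

definition continuous_arr ::
  "('o, 'a) cat \<Rightarrow> 'o \<times> ('u rel \<Rightarrow> 'a) \<Rightarrow> 'o \<times> ('u rel \<Rightarrow> 'a) \<Rightarrow> 'a \<Rightarrow> bool" where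
  "continuous_arr C A B f \<longleftrightarrow>
     f \<in> hom C (fst A) (fst B) \<and>
     (\<forall>P\<in>dirsets.
        factors_through C (times_map C (power_map C P f) f \<cdot>\<^bsub>C\<^esub> snd A P) (snd B P))"

text \<open>Arrows record their domain and codomain, which the underlying arrow of \<open>C\<close> does not determine.\<close>

definition Top ::
  "'u itself \<Rightarrow> ('o, 'a) cat \<Rightarrow>
     ('o \<times> ('u rel \<Rightarrow> 'a), ('o \<times> ('u rel \<Rightarrow> 'a)) \<times> ('o \<times> ('u rel \<Rightarrow> 'a)) \<times> 'a) cat" where
  "Top u C =
     \<lparr>Obj = top_objects C,
      Arr = {(A, B, f). A \<in> top_objects C \<and> B \<in> top_objects C \<and> continuous_arr C A B f},
      Dom = (\<lambda>(A, B, f). A),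
      Cod = (\<lambda>(A, B, f). B),
      Id = (\<lambda>A. (A, A, Id C (fst A))),
      Comp = (\<lambda>(B', D, g) (A, B, f). (A, D, g \<cdot>\<^bsub>C\<^esub> f))\<rparr>"

definition forget ::
  "('o \<times> 't, ('o \<times> 't) \<times> ('o \<times> 't) \<times> 'a, 'o, 'a) cat_map" where
  "forget = \<lparr>on_obj = fst, on_arr = (\<lambda>(A, B, f). f)\<rparr>"


section \<open>Topological functors\<close>

text \<open>
  Families are indexed by arbitrary sets of type \<open>'i\<close>. In statements \<open>'i\<close> is a type variable, so
  there is no bound on their size.
\<close>

definition is_initial_lift ::
  "('o1, 'a1) cat \<Rightarrow> ('o2, 'a2) cat \<Rightarrow> ('o1, 'a1, 'o2, 'a2) cat_map \<Rightarrow>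
     'i set \<Rightarrow> 'o2 \<Rightarrow> ('i \<Rightarrow> 'o1) \<Rightarrow> ('i \<Rightarrow> 'a2) \<Rightarrow> 'o1 \<Rightarrow> bool" where
  "is_initial_lift A C U I X S f L \<longleftrightarrow>
     L \<in> Obj A \<and> on_obj U L = X \<and>
     (\<forall>i\<in>I. \<exists>g\<in>hom A L (S i). on_arr U g = f i) \<and>
     (\<forall>B\<in>Obj A. \<forall>h\<in>hom C (on_obj U B) X.
        (\<exists>k\<in>hom A B L. on_arr U k = h) \<longleftrightarrow>
        (\<forall>i\<in>I. \<exists>k\<in>hom A B (S i). on_arr U k = f i \<cdot>\<^bsub>C\<^esub> h))"

definition topological_functor ::
  "'i itself \<Rightarrow> ('o1, 'a1) cat \<Rightarrow> ('o2, 'a2) cat \<Rightarrow> ('o1, 'a1, 'o2, 'a2) cat_map \<Rightarrow> bool" where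
  "topological_functor _ A C U \<longleftrightarrow>
     cat_functor A C U \<and> faithful A U \<and>
     (\<forall>(I :: 'i set) X S f.
        X \<in> Obj C \<and> (\<forall>i\<in>I. S i \<in> Obj A \<and> f i \<in> hom C X (on_obj U (S i))) \<longrightarrow>
        (\<exists>L. is_initial_lift A C U I X S f L))"


section \<open>Existence of small directed sets\<close>

lemma small_nat_iff: "small TYPE(nat) A \<longleftrightarrow> finite A"
  unfolding small_def
  by (metis finite_lesspoll_infinite infinite_UNIV_nat infinite_le_lepoll
      lesspoll_not_refl lesspoll_trans1)

lemma universe_nat: "universe TYPE(nat)"
  by (simp add: universe_def small_nat_iff)

lemma small_lepoll: "small u B \<Longrightarrow> A \<lesssim> B \<Longrightarrow> small u A"
  unfolding small_def by (rule lesspoll_trans1)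

lemma small_inj: "small u B \<Longrightarrow> inj_on f A \<Longrightarrow> f ` A \<subseteq> B \<Longrightarrow> small u A"
  by (rule small_lepoll) (auto simp: lepoll_def)

lemma small_copy:
  fixes A :: "'b set"
  assumes "small TYPE('u) A"
  obtains f :: "'b \<Rightarrow> 'u" where "inj_on f A" "small TYPE('u) (f ` A)"
proof -
  from assms obtain f :: "'b \<Rightarrow> 'u" where f: "inj_on f A"
    unfolding small_def lesspoll_def lepoll_def by blast
  moreover have "small TYPE('u) (f ` A)"
    using small_lepoll[OF assms image_lepoll] .
  ultimately show ?thesis by (rule that)
qed

lemma small_Pow:
  fixes A :: "'b set"
  assumes "universe TYPE('u)" "small TYPE('u) A"
  shows "small TYPE('u) (Pow A)"
proof -
  obtain f :: "'b \<Rightarrow> 'u" where f: "inj_on f A" "small TYPE('u) (f ` A)"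
    using small_copy[OF assms(2)] .
  then have "small TYPE('u) (Pow (f ` A))"
    using assms(1) by (auto simp: universe_def)
  moreover have "inj_on ((`) f) (Pow A)"
    using f(1) by (rule inj_on_image_Pow)
  ultimately show ?thesis by (rule small_inj) auto
qed

lemma small_Un:
  fixes A B :: "'u set"
  assumes "universe TYPE('u)" "small TYPE('u) A" "small TYPE('u) B"
  shows "small TYPE('u) (A \<union> B)"
proof -
  have "small TYPE('u) {A, B}"
    unfolding small_def using assms(1) by (simp add: universe_def finite_lesspoll_infinite)
  moreover have "(\<forall>D\<in>{A, B}. small TYPE('u) D)"
    using assms(2,3) by simp
  ultimately have "small TYPE('u) (\<Union>{A, B})"
    using assms(1) unfolding universe_def by blast
  then show ?thesis by simp
qed

lemma small_Times:
  fixes A :: "'b set" and B :: "'c set"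
  assumes u: "universe TYPE('u)" and "small TYPE('u) A" "small TYPE('u) B"
  shows "small TYPE('u) (A \<times> B)"
proof -
  obtain f :: "'b \<Rightarrow> 'u" where f: "inj_on f A" "small TYPE('u) (f ` A)"
    using small_copy[OF assms(2)] .
  obtain g :: "'c \<Rightarrow> 'u" where g: "inj_on g B" "small TYPE('u) (g ` B)"
    using small_copy[OF assms(3)] .
  let ?k = "\<lambda>(a, b). {{f a}, {f a, g b}}"
  have "small TYPE('u) (Pow (Pow (f ` A \<union> g ` B)))"
    by (intro small_Pow small_Un u f g)
  moreover have "inj_on ?k (A \<times> B)"
  proof (rule inj_onI, clarify)
    fix a b a' b'
    assume ab: "a \<in> A" "b \<in> B" "a' \<in> A" "b' \<in> B"
      and eq: "{{f a}, {f a, g b}} = {{f a'}, {f a', g b'}}"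
    from eq have "f a = f a' \<and> g b = g b'"
      by (metis doubleton_eq_iff insert_absorb2)
    then show "a = a' \<and> b = b'"
      using ab inj_onD[OF f(1)] inj_onD[OF g(1)] by simp
  qed
  moreover have "?k ` (A \<times> B) \<subseteq> Pow (Pow (f ` A \<union> g ` B))"
    by auto
  ultimately show ?thesis by (rule small_inj)
qed

lemma small_PiE:
  fixes A :: "'u set" and B :: "'u \<Rightarrow> 'u set"
  assumes u: "universe TYPE('u)" and A: "small TYPE('u) A" and B: "\<And>a. a \<in> A \<Longrightarrow> small TYPE('u) (B a)"
  shows "small TYPE('u) (Pi\<^sub>E A B)"
proof -
  have "small TYPE('u) (B ` A)"
    using small_lepoll[OF A image_lepoll] .
  then have "small TYPE('u) (\<Union>(B ` A))"
    using u B unfolding universe_def by blast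
  then have "small TYPE('u) (Pow (A \<times> \<Union>(B ` A)))"
    by (intro small_Pow small_Times u A)
  moreover have "inj_on (\<lambda>f. (\<lambda>a. (a, f a)) ` A) (Pi\<^sub>E A B)"
  proof (rule inj_onI)
    fix f g assume "f \<in> Pi\<^sub>E A B" "g \<in> Pi\<^sub>E A B" "(\<lambda>a. (a, f a)) ` A = (\<lambda>a. (a, g a)) ` A"
    then show "f = g" by (intro PiE_ext[of f A B g]) auto
  qed
  moreover have "(\<lambda>f. (\<lambda>a. (a, f a)) ` A) ` Pi\<^sub>E A B \<subseteq> Pow (A \<times> \<Union>(B ` A))"
    by (auto simp: PiE_def Pi_def)
  ultimately show ?thesis by (rule small_inj)
qed

lemma directedD:
  assumes "directed P"
  shows "p \<in> Field P \<Longrightarrow> (p, p) \<in> P" "trans P" "Field P \<noteq> {}"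
    "p \<in> Field P \<Longrightarrow> q \<in> Field P \<Longrightarrow> \<exists>r\<in>Field P. (p, r) \<in> P \<and> (q, r) \<in> P"
  using assms by (auto simp: directed_def preorder_on_def refl_on_def)

lemma directedI:
  assumes "\<And>p. p \<in> A \<Longrightarrow> (p, p) \<in> P" "P \<subseteq> A \<times> A" "trans P" "A \<noteq> {}"
    "\<And>p q. p \<in> A \<Longrightarrow> q \<in> A \<Longrightarrow> \<exists>r\<in>A. (p, r) \<in> P \<and> (q, r) \<in> P"
  shows "directed P \<and> Field P = A"
proof -
  have "Field P = A"
    using assms(1,2) by (auto simp: Field_def)
  then show ?thesis
    using assms by (auto simp: directed_def preorder_on_def refl_on_def)
qed

lemma iteration_order_iff:
  "(x, y) \<in> iteration_order P Q \<longleftrightarrow>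
     x \<in> Field P \<times> (\<Pi>\<^sub>E p\<in>Field P. Field (Q p)) \<and>
     y \<in> Field P \<times> (\<Pi>\<^sub>E p\<in>Field P. Field (Q p)) \<and>
     (fst x, fst y) \<in> P \<and> (\<forall>p\<in>Field P. (snd x p, snd y p) \<in> Q p)"
  unfolding iteration_order_def Let_def by simp

lemma directed_iteration_order:
  assumes P: "directed P" and Q: "\<And>p. p \<in> Field P \<Longrightarrow> directed (Q p)"
  shows "directed (iteration_order P Q) \<and>
    Field (iteration_order P Q) = Field P \<times> (\<Pi>\<^sub>E p\<in>Field P. Field (Q p))"
proof (rule directedI)
  let ?S = "Field P \<times> (\<Pi>\<^sub>E p\<in>Field P. Field (Q p))"
  have S: "fst x \<in> Field P" "p \<in> Field P \<Longrightarrow> snd x p \<in> Field (Q p)" if "x \<in> ?S" for x p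
    using that by (auto simp only: mem_Times_iff dest: PiE_mem)
  show "(x, x) \<in> iteration_order P Q" if "x \<in> ?S" for x
    unfolding iteration_order_iff
    using that S[OF that] directedD(1)[OF P] directedD(1)[OF Q] by blast
  show "iteration_order P Q \<subseteq> ?S \<times> ?S"
    by (rule subrelI) (simp only: iteration_order_iff mem_Sigma_iff simp_thms)
  show "trans (iteration_order P Q)"
    by (rule transI, unfold iteration_order_iff)
      (metis directedD(2)[OF P] directedD(2)[OF Q] transE)
  have "\<exists>q. q \<in> Field (Q p)" if "p \<in> Field P" for p
    using directedD(3)[OF Q[OF that]] by blast
  then obtain q where q: "\<And>p. p \<in> Field P \<Longrightarrow> q p \<in> Field (Q p)"
    by metis
  obtain p where "p \<in> Field P"
    using directedD(3)[OF P] by blast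
  with q have "(p, restrict q (Field P)) \<in> ?S"
    by (simp add: restrict_PiE_iff)
  then show "?S \<noteq> {}" by (metis empty_iff)
  show "\<exists>z\<in>?S. (x, z) \<in> iteration_order P Q \<and> (y, z) \<in> iteration_order P Q"
    if x: "x \<in> ?S" and y: "y \<in> ?S" for x y
  proof -
    obtain r where r: "r \<in> Field P" "(fst x, r) \<in> P" "(fst y, r) \<in> P"
      using directedD(4)[OF P S(1)[OF x] S(1)[OF y]] by blast
    have "\<exists>c. c \<in> Field (Q p) \<and> (snd x p, c) \<in> Q p \<and> (snd y p, c) \<in> Q p"
      if p: "p \<in> Field P" for p
      using directedD(4)[OF Q[OF p] S(2)[OF x p] S(2)[OF y p]] by blast
    then obtain c where c: "\<And>p. p \<in> Field P \<Longrightarrow>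
        c p \<in> Field (Q p) \<and> (snd x p, c p) \<in> Q p \<and> (snd y p, c p) \<in> Q p"
      by metis
    let ?z = "(r, restrict c (Field P))"
    have z: "?z \<in> ?S"
      using r(1) c by (simp add: restrict_PiE_iff)
    then show ?thesis
      unfolding iteration_order_iff using x y r c
      by (intro bexI[of _ ?z] conjI) simp_all
  qed
qed

lemma directed_copy:
  fixes S :: "'b rel" and f :: "'b \<Rightarrow> 'c"
  assumes S: "directed S" and f: "inj_on f (Field S)"
  defines "R \<equiv> {(f x, f y) | x y. (x, y) \<in> S}"
  shows "directed R" "Field R = f ` Field S" "order_iso R S (the_inv_into (Field S) f)"
proof -
  have R_iff: "(a, b) \<in> R \<longleftrightarrow> (\<exists>x y. a = f x \<and> b = f y \<and> (x, y) \<in> S)" for a b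
    by (simp add: R_def)
  have mem: "(f x, f y) \<in> R \<longleftrightarrow> (x, y) \<in> S" if x: "x \<in> Field S" and y: "y \<in> Field S" for x y
  proof
    assume "(f x, f y) \<in> R"
    then obtain x' y' where *: "f x = f x'" "f y = f y'" "(x', y') \<in> S"
      using R_iff by blast
    have "x = x'" "y = y'"
      using inj_onD[OF f *(1) x FieldI1[OF *(3)]] inj_onD[OF f *(2) y FieldI2[OF *(3)]] .
    then show "(x, y) \<in> S" using *(3) by simp
  next
    assume "(x, y) \<in> S"
    then show "(f x, f y) \<in> R" using R_iff by blast
  qed
  have R: "directed R \<and> Field R = f ` Field S"
  proof (rule directedI)
    show "(p, p) \<in> R" if "p \<in> f ` Field S" for p
      using that mem directedD(1)[OF S] by blast
    show "R \<subseteq> f ` Field S \<times> f ` Field S"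
    proof (rule subrelI)
      fix a b assume "(a, b) \<in> R"
      then obtain x y where xy: "a = f x" "b = f y" "(x, y) \<in> S"
        using R_iff by blast
      show "(a, b) \<in> f ` Field S \<times> f ` Field S"
        using xy(1,2) FieldI1[OF xy(3)] FieldI2[OF xy(3)] by blast
    qed
    show "trans R"
    proof (rule transI)
      fix a b c assume ab: "(a, b) \<in> R" and bc: "(b, c) \<in> R"
      obtain x y where xy: "a = f x" "b = f y" "(x, y) \<in> S"
        using ab R_iff by blast
      obtain y' z where yz: "b = f y'" "c = f z" "(y', z) \<in> S"
        using bc R_iff by blast
      have "y = y'"
        using inj_onD[OF f _ FieldI2[OF xy(3)] FieldI1[OF yz(3)]] xy(2) yz(1) by simp
      then have "(x, z) \<in> S"
        using transD[OF directedD(2)[OF S]] xy(3) yz(3) by simp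
      then show "(a, c) \<in> R"
        using xy(1) yz(2) R_iff by blast
    qed
    show "f ` Field S \<noteq> {}"
      using directedD(3)[OF S] by simp
    show "\<exists>r\<in>f ` Field S. (p, r) \<in> R \<and> (q, r) \<in> R"
      if p: "p \<in> f ` Field S" and q: "q \<in> f ` Field S" for p q
    proof -
      obtain x y where xy: "p = f x" "x \<in> Field S" "q = f y" "y \<in> Field S"
        using p q by blast
      obtain z where "z \<in> Field S" "(x, z) \<in> S" "(y, z) \<in> S"
        using directedD(4)[OF S xy(2,4)] by blast
      then show ?thesis using xy mem by blast
    qed
  qed
  then show "directed R" "Field R = f ` Field S" by simp_all
  show "order_iso R S (the_inv_into (Field S) f)"
    unfolding order_iso_def
  proof (intro conjI ballI)
    show "bij_betw (the_inv_into (Field S) f) (Field R) (Field S)"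
      using R f by (simp add: bij_betw_the_inv_into inj_on_imp_bij_betw)
    fix a b assume "a \<in> Field R" "b \<in> Field R"
    then obtain x y where xy: "a = f x" "b = f y" "x \<in> Field S" "y \<in> Field S"
      using R by blast
    then show "(a, b) \<in> R \<longleftrightarrow> (the_inv_into (Field S) f a, the_inv_into (Field S) f b) \<in> S"
      using mem[OF xy(3,4)] by (simp add: the_inv_into_f_f[OF f])
  qed
qed

lemma ex_iteration_copy:
  fixes P :: "'u rel" and Q :: "'u \<Rightarrow> 'u rel"
  assumes u: "universe TYPE('u)" and P: "P \<in> dirsets"
    and Q: "\<And>p. p \<in> Field P \<Longrightarrow> Q p \<in> dirsets"
  shows "\<exists>R\<in>dirsets. \<exists>e. order_iso (R :: 'u rel) (iteration_order P Q) e"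
proof -
  have dirsetsD: "directed R" "small TYPE('u) (Field R)" if "R \<in> dirsets" for R :: "'u rel"
    using that by (simp_all add: dirsets_def)
  define S where "S = iteration_order P Q"
  have "directed S \<and> Field S = Field P \<times> (\<Pi>\<^sub>E p\<in>Field P. Field (Q p))"
    unfolding S_def by (rule directed_iteration_order[OF dirsetsD(1)[OF P] dirsetsD(1)[OF Q]])
  moreover have "small TYPE('u) (Field P \<times> (\<Pi>\<^sub>E p\<in>Field P. Field (Q p)))"
    by (rule small_Times[OF u dirsetsD(2)[OF P] small_PiE[OF u dirsetsD(2)[OF P] dirsetsD(2)[OF Q]]])
  ultimately have S: "directed S" "small TYPE('u) (Field S)"
    by simp_all
  obtain f :: "'u \<times> ('u \<Rightarrow> 'u) \<Rightarrow> 'u" where f: "inj_on f (Field S)" "small TYPE('u) (f ` Field S)"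
    using small_copy[OF S(2)] .
  note copy = directed_copy[OF S(1) f(1)]
  have "{(f x, f y) | x y. (x, y) \<in> S} \<in> dirsets"
    unfolding dirsets_def mem_Collect_eq copy(2) using copy(1) f(2) by (rule conjI)
  with copy(3) show ?thesis
    unfolding S_def by (intro bexI exI)
qed

end

theory Submission
  imports Defs
begin

text \<open>
  The proof reads subobjects of \<open>X\<^sup>P \<times> X\<close> through generalized elements. An arrow from \<open>Z\<close> to
  \<open>X\<^sup>P \<times> X\<close> is a net of arrows \<open>Z \<rightarrow> X\<close> indexed by \<open>P\<close>, together with one more arrow
  \<open>Z \<rightarrow> X\<close>, its candidate limit. The net converges to this limit if the arrow factors through
  \<open>\<iota>\<^sub>P\<close>. The universal properties of products and fiber products turn each axiom of a topology into
  the familiar statement about convergent nets, with \<open>Z\<close> arbitrary: constant nets converge, subnets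
  of convergent nets converge, convergence is local, and iterated limits are limits along the product
  order. In the same way, a morphism is continuous iff it preserves convergence
  (\<open>continuous_arr_iff\<close>).

  In these terms the initial topology for a family \<open>f\<^sub>i : X \<rightarrow> S\<^sub>i\<close> is forced: a net converges iff
  all its images under the \<open>f\<^sub>i\<close> do. Every axiom says that some convergences imply another one, and
  composition with \<open>f\<^sub>i\<close> commutes with the operations on nets involved, so the axioms for \<open>X\<close>
  follow from those for the \<open>S\<^sub>i\<close> (\<open>ex_initial_topology\<close>). What has to be shown is that this
  convergence relation is represented by a subobject of \<open>X\<^sup>P \<times> X\<close>. It is the intersection of the
  pullbacks of the subobjects belonging to the \<open>S\<^sub>i\<close>. The family may be large, and here
  wellpoweredness enters: the family contains only a small set of subobjects up to isomorphism, so
  its intersection is a small limit (\<open>large_intersection\<close>).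

  Cocompleteness is a general property of topological functors
  (\<open>topological_functor_lifts_colimits\<close>): the colimit of the underlying diagram receives the initial
  structure for all arrows out of it whose composites with the colimit cocone are morphisms. The
  family of these arrows may be large, which is why initial lifts of large families matter.
\<close>


section \<open>Composition, pullbacks and monomorphisms\<close>

context category
begin

lemma homD:
  assumes "f \<in> hom C A B"
  shows "f \<in> Arr C" "Dom C f = A" "Cod C f = B" "A \<in> Obj C" "B \<in> Obj C"
  using assms dom_obj cod_obj by (auto simp: hom_def)

lemma arr_hom: "f \<in> Arr C \<Longrightarrow> f \<in> hom C (Dom C f) (Cod C f)"
  by (simp add: hom_def)

lemma arr_comp [simp]:
  assumes "f \<in> Arr C" "g \<in> Arr C" "Cod C f = Dom C g"
  shows "g \<cdot> f \<in> Arr C" "Dom C (g \<cdot> f) = Dom C f" "Cod C (g \<cdot> f) = Cod C g"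
proof -
  have "g \<cdot> f \<in> hom C (Dom C f) (Cod C g)"
    by (rule comp_hom[OF arr_hom[OF assms(1)]]) (simp add: hom_def assms)
  then show "g \<cdot> f \<in> Arr C" "Dom C (g \<cdot> f) = Dom C f" "Cod C (g \<cdot> f) = Cod C g"
    by (simp_all add: hom_def)
qed

lemma arr_comp_assoc [simp]:
  assumes "f \<in> Arr C" "g \<in> Arr C" "h \<in> Arr C" "Cod C f = Dom C g" "Cod C g = Dom C h"
  shows "(h \<cdot> g) \<cdot> f = h \<cdot> (g \<cdot> f)"
  by (rule comp_assoc[of f "Dom C f" "Dom C g" g "Dom C h" h "Cod C h"])
    (simp_all add: hom_def assms)

lemma factors_throughI:
  "m \<cdot> h = f \<Longrightarrow> h \<in> hom C (Dom C f) (Dom C m) \<Longrightarrow> factors_through C f m"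
  by (auto simp: factors_through_def)

lemma factors_through_hom_iff:
  "f \<in> hom C Z Y \<Longrightarrow> factors_through C f m \<longleftrightarrow> (\<exists>h\<in>hom C Z (Dom C m). m \<cdot> h = f)"
  by (auto simp: factors_through_def hom_def)

lemma factors_through_comp:
  assumes "factors_through C f m" "m \<in> hom C A Y" "f \<in> hom C B Y" "k \<in> hom C Z B"
  shows "factors_through C (f \<cdot> k) m"
proof -
  obtain h where h: "h \<in> hom C B A" "m \<cdot> h = f"
    using assms(1-3) by (auto simp: factors_through_def hom_def)
  then have "m \<cdot> (h \<cdot> k) = f \<cdot> k"
    using assms(2,4) comp_assoc by metis
  then show ?thesis
    by (rule factors_throughI) (use assms h in \<open>simp add: hom_def\<close>)
qed

lemma pullback:
  assumes L: "is_pullback C f g L p q" and f: "f \<in> hom C A Y" and g: "g \<in> hom C B Y"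
  shows pullback_hom: "p \<in> hom C L A" "q \<in> hom C L B"
    and pullback_eq: "f \<cdot> p = g \<cdot> q"
    and pullback_lift: "r \<in> hom C Z A \<Longrightarrow> s \<in> hom C Z B \<Longrightarrow> f \<cdot> r = g \<cdot> s \<Longrightarrow>
      \<exists>!h. h \<in> hom C Z L \<and> p \<cdot> h = r \<and> q \<cdot> h = s"
proof -
  have [simp]: "Dom C f = A" "Dom C g = B"
    using homD(2)[OF f] homD(2)[OF g] .
  show "p \<in> hom C L A" "q \<in> hom C L B" "f \<cdot> p = g \<cdot> q"
    using L by (simp_all add: is_pullback_def)
  have "\<forall>Z\<in>Obj C. \<forall>r\<in>hom C Z A. \<forall>s\<in>hom C Z B. f \<cdot> r = g \<cdot> s \<longrightarrow>
      (\<exists>!h. h \<in> hom C Z L \<and> p \<cdot> h = r \<and> q \<cdot> h = s)"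
    using L by (simp add: is_pullback_def)
  note lift = this[rule_format]
  show "\<exists>!h. h \<in> hom C Z L \<and> p \<cdot> h = r \<and> q \<cdot> h = s"
    if "r \<in> hom C Z A" "s \<in> hom C Z B" "f \<cdot> r = g \<cdot> s"
    by (rule lift[OF homD(4)[OF that(1)] that])
qed

lemma mono_arrI:
  assumes m: "m \<in> hom C A Y"
    and eq: "\<And>Z g h. g \<in> hom C Z A \<Longrightarrow> h \<in> hom C Z A \<Longrightarrow> m \<cdot> g = m \<cdot> h \<Longrightarrow> g = h"
  shows "mono_arr C m"
  using m eq by (auto simp: mono_arr_def hom_def[of C A Y])

lemma mono_arrD:
  assumes "mono_arr C m" "m \<in> hom C A Y" "g \<in> hom C Z A" "h \<in> hom C Z A" "m \<cdot> g = m \<cdot> h"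
  shows "g = h"
proof -
  have "\<forall>Z\<in>Obj C. \<forall>g\<in>hom C Z A. \<forall>h\<in>hom C Z A. m \<cdot> g = m \<cdot> h \<longrightarrow> g = h"
    using assms(1) homD(2)[OF assms(2)] by (simp add: mono_arr_def)
  from this[rule_format, OF homD(4)[OF assms(3)] assms(3-5)] show ?thesis .
qed

lemma factors_through_trans:
  assumes z: "z \<in> hom C Z Y" and m: "m \<in> hom C A Y" and n: "n \<in> hom C B Y"
    and "factors_through C z m" "factors_through C m n"
  shows "factors_through C z n"
proof -
  obtain k where k: "k \<in> hom C Z A" "m \<cdot> k = z"
    using assms(4) factors_through_hom_iff[OF z] homD(2)[OF m] by auto
  with factors_through_comp[OF assms(5) n m k(1)] show ?thesis
    by simp
qed

lemma pullback_mono: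
  assumes L: "is_pullback C n g L p q" and n: "n \<in> hom C B W" and g: "g \<in> hom C Y W"
    and mono: "mono_arr C n"
  shows "mono_arr C q"
    and "z \<in> hom C Z Y \<Longrightarrow> factors_through C z q \<longleftrightarrow> factors_through C (g \<cdot> z) n"
proof -
  note p = pullback_hom(1)[OF L n g] and q = pullback_hom(2)[OF L n g]
    and eq = pullback_eq[OF L n g] and lift = pullback_lift[OF L n g]
  show "mono_arr C q"
  proof (rule mono_arrI[OF q])
    fix Z a b
    assume a: "a \<in> hom C Z L" and b: "b \<in> hom C Z L" and ab: "q \<cdot> a = q \<cdot> b"
    have sq: "n \<cdot> (p \<cdot> c) = g \<cdot> (q \<cdot> c)" if "c \<in> hom C Z L" for c
      using comp_assoc[OF that p n] comp_assoc[OF that q g] eq by simp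
    have "n \<cdot> (p \<cdot> a) = n \<cdot> (p \<cdot> b)"
      using sq[OF a] sq[OF b] ab by simp
    then have "p \<cdot> a = p \<cdot> b"
      by (rule mono_arrD[OF mono n comp_hom[OF a p] comp_hom[OF b p]])
    then show "a = b"
      using lift[OF comp_hom[OF b p] comp_hom[OF b q] sq[OF b]] a b ab by blast
  qed
  assume z: "z \<in> hom C Z Y"
  show "factors_through C z q \<longleftrightarrow> factors_through C (g \<cdot> z) n"
  proof
    assume "factors_through C z q"
    then obtain k where k: "k \<in> hom C Z L" "q \<cdot> k = z"
      using factors_through_hom_iff[OF z] homD(2)[OF q] by auto
    have "n \<cdot> (p \<cdot> k) = g \<cdot> z"
      using comp_assoc[OF k(1) p n] comp_assoc[OF k(1) q g] eq k(2) by simp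
    then show "factors_through C (g \<cdot> z) n"
      using factors_through_hom_iff[OF comp_hom[OF z g]] homD(2)[OF n] comp_hom[OF k(1) p] by blast
  next
    assume "factors_through C (g \<cdot> z) n"
    then obtain k where k: "k \<in> hom C Z B" "n \<cdot> k = g \<cdot> z"
      using factors_through_hom_iff[OF comp_hom[OF z g]] homD(2)[OF n] by auto
    then show "factors_through C z q"
      using lift[OF k(1) z k(2)] factors_through_hom_iff[OF z] homD(2)[OF q] by blast
  qed
qed

end


section \<open>Limits in a complete category\<close>

text \<open>
  Products and wide pullbacks are limits of diagrams indexed by preorders: \<open>F\<close> gives the objects and
  \<open>m a b\<close> is the arrow for \<open>a \<le> b\<close>.
\<close>

definition is_preorder_limit ::
  "('o, 'a) cat \<Rightarrow> 'j set \<Rightarrow> 'j rel \<Rightarrow> ('j \<Rightarrow> 'o) \<Rightarrow> ('j \<Rightarrow> 'j \<Rightarrow> 'a) \<Rightarrow> 'o \<Rightarrow> ('j \<Rightarrow> 'a) \<Rightarrow> bool" where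
  "is_preorder_limit C A r F m L p \<longleftrightarrow>
     L \<in> Obj C \<and> (\<forall>a\<in>A. p a \<in> hom C L (F a)) \<and> (\<forall>(a, b)\<in>r. m a b \<cdot>\<^bsub>C\<^esub> p a = p b) \<and>
     (\<forall>Z\<in>Obj C. \<forall>q. (\<forall>a\<in>A. q a \<in> hom C Z (F a)) \<and> (\<forall>(a, b)\<in>r. m a b \<cdot>\<^bsub>C\<^esub> q a = q b) \<longrightarrow>
       (\<exists>!h. h \<in> hom C Z L \<and> (\<forall>a\<in>A. p a \<cdot>\<^bsub>C\<^esub> h = q a)))"

locale small_complete_category = category C for C :: "('o, 'a) cat" (structure) +
  fixes univ :: "'u itself"
  assumes universe: "universe TYPE('u)"
    and complete: "complete_cat TYPE('u) C"
begin

lemma small_finite: "finite A \<Longrightarrow> small TYPE('u) A"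
  using universe by (simp add: universe_def small_def finite_lesspoll_infinite)

text \<open>
  Completeness speaks of diagrams indexed by categories with objects and arrows in \<open>'u\<close>. The preorder
  is therefore copied along injections of its elements and of its pairs into \<open>'u\<close>; this makes limits
  available over index sets of any type, such as sets of subsets of \<open>'u\<close>.
\<close>

lemma preorder_limit:
  fixes A :: "'j set" and r :: "'j rel"
  assumes A: "small TYPE('u) A" and r: "r \<subseteq> A \<times> A" "refl_on A r" "trans r"
    and F: "\<And>a. a \<in> A \<Longrightarrow> F a \<in> Obj C"
    and m: "\<And>a b. (a, b) \<in> r \<Longrightarrow> m a b \<in> hom C (F a) (F b)"
    and m_id: "\<And>a. a \<in> A \<Longrightarrow> m a a = Id C (F a)"
    and m_comp: "\<And>a b c. (a, b) \<in> r \<Longrightarrow> (b, c) \<in> r \<Longrightarrow> m b c \<cdot> m a b = m a c"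
  shows "\<exists>L p. is_preorder_limit C A r F m L p"
proof -
  obtain g :: "'j \<Rightarrow> 'u" where g: "inj_on g A" "small TYPE('u) (g ` A)"
    using small_copy[OF A] .
  have "small TYPE('u) r"
    by (rule small_inj[OF small_Times[OF universe A A], of id]) (use r(1) in auto)
  then obtain k :: "'j \<times> 'j \<Rightarrow> 'u" where k: "inj_on k r" "small TYPE('u) (k ` r)"
    using small_copy by blast
  define g' where "g' = the_inv_into A g"
  define k' where "k' = the_inv_into r k"
  have g': "g' (g a) = a" if "a \<in> A" for a
    using that g(1) by (simp add: g'_def the_inv_into_f_f)
  have k': "k' (k e) = e" if "e \<in> r" for e
    using that k(1) by (simp add: k'_def the_inv_into_f_f)
  define J :: "('u, 'u) cat" where
    "J = \<lparr>Obj = g ` A, Arr = k ` r, Dom = (\<lambda>e. g (fst (k' e))), Cod = (\<lambda>e. g (snd (k' e))),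
          Id = (\<lambda>a. k (g' a, g' a)), Comp = (\<lambda>e d. k (fst (k' d), snd (k' e)))\<rparr>"
  define D where "D = \<lparr>on_obj = (\<lambda>a. F (g' a)), on_arr = (\<lambda>e. m (fst (k' e)) (snd (k' e)))\<rparr>"
  have mem: "a \<in> A" "b \<in> A" if "(a, b) \<in> r" for a b
    using that r(1) by auto
  have rfl: "(a, a) \<in> r" if "a \<in> A" for a
    using that r(2) by (simp add: refl_on_def)
  have homJ: "e \<in> hom J x y \<longleftrightarrow> (\<exists>a b. e = k (a, b) \<and> x = g a \<and> y = g b \<and> (a, b) \<in> r)" for e x y
    by (force simp: hom_def J_def k')
  have g_eq: "g a = g b \<longleftrightarrow> a = b" if "a \<in> A" "b \<in> A" for a b
    using that g(1) by (auto dest: inj_onD)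
  have Jcomp: "k (b, c) \<cdot>\<^bsub>J\<^esub> k (a, b) = k (a, c)" if "(a, b) \<in> r" "(b, c) \<in> r" for a b c
    using that by (simp add: J_def k')
  have JId: "Id J (g a) = k (a, a)" if "a \<in> A" for a
    using that by (simp add: J_def g')
  have catJ: "category J"
  proof
    show "Dom J f \<in> Obj J" "Cod J f \<in> Obj J" if "f \<in> Arr J" for f
      using that mem by (auto simp: J_def k')
    show "Id J x \<in> hom J x x" if "x \<in> Obj J" for x
    proof -
      obtain a where a: "a \<in> A" "x = g a"
        using \<open>x \<in> Obj J\<close> by (auto simp: J_def)
      then show ?thesis
        unfolding homJ using JId[OF a(1)] rfl[OF a(1)] by blast
    qed
    show "g \<cdot>\<^bsub>J\<^esub> f \<in> hom J A D" if "f \<in> hom J A B" "g \<in> hom J B D" for f A B g D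
      using that unfolding homJ by (metis Jcomp g_eq mem transD[OF r(3)])
    show "Id J B \<cdot>\<^bsub>J\<^esub> f = f" "f \<cdot>\<^bsub>J\<^esub> Id J A = f" if "f \<in> hom J A B" for f A B
      using that unfolding homJ by (metis Jcomp JId mem rfl)+
    show "(h \<cdot>\<^bsub>J\<^esub> g) \<cdot>\<^bsub>J\<^esub> f = h \<cdot>\<^bsub>J\<^esub> (g \<cdot>\<^bsub>J\<^esub> f)"
      if "f \<in> hom J A B" "g \<in> hom J B D" "h \<in> hom J D E" for f A B g D h E
      using that unfolding homJ by (metis Jcomp g_eq mem transD[OF r(3)])
  qed
  have "cat_functor J C D"
  proof (intro cat_functor.intro cat_functor_axioms.intro catJ category_axioms)
    show "on_obj D X \<in> Obj C" if "X \<in> Obj J" for X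
      using that by (auto simp: J_def D_def g' F)
    show "on_arr D f \<in> hom C (on_obj D X) (on_obj D Y)" if "f \<in> hom J X Y" for f X Y
      using that unfolding homJ by (auto simp: D_def g' k' mem m)
    show "on_arr D (Id J X) = Id C (on_obj D X)" if "X \<in> Obj J" for X
      using that by (auto simp: D_def J_def g' k' rfl m_id)
    show "on_arr D (g \<cdot>\<^bsub>J\<^esub> f) = on_arr D g \<cdot> on_arr D f"
      if "f \<in> hom J X Y" "g \<in> hom J Y Z" for f g X Y Z
    proof -
      obtain a b c where "f = k (a, b)" "g = k (b, c)" "(a, b) \<in> r" "(b, c) \<in> r"
        using \<open>f \<in> hom J X Y\<close> \<open>g \<in> hom J Y Z\<close> unfolding homJ by (metis g_eq mem)
      then show ?thesis
        using transD[OF r(3)] by (simp add: Jcomp D_def k' m_comp)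
    qed
  qed
  moreover have "small TYPE('u) (Obj J)" "small TYPE('u) (Arr J)"
    using g(2) k(2) by (simp_all add: J_def)
  ultimately obtain L p where L: "is_limit J C D L p"
    using complete unfolding complete_cat_def by blast
  have cone: "is_cone J C D Z q \<longleftrightarrow>
      Z \<in> Obj C \<and> (\<forall>a\<in>A. q (g a) \<in> hom C Z (F a)) \<and> (\<forall>(a, b)\<in>r. m a b \<cdot> q (g a) = q (g b))"
    for Z q
    by (auto simp: is_cone_def J_def D_def g' k')
  have univ: "\<exists>!h. h \<in> hom C Z L \<and> (\<forall>a\<in>A. p (g a) \<cdot> h = q a)"
    if "Z \<in> Obj C" "(\<forall>a\<in>A. q a \<in> hom C Z (F a)) \<and> (\<forall>(a, b)\<in>r. m a b \<cdot> q a = q b)" for Z q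
  proof -
    have "is_cone J C D Z (\<lambda>j. q (g' j))"
      unfolding cone using that mem by (auto simp: g')
    then have "\<exists>!h. h \<in> hom C Z L \<and> (\<forall>j\<in>Obj J. p j \<cdot> h = q (g' j))"
      using L unfolding is_limit_def by blast
    moreover have "(\<forall>j\<in>Obj J. p j \<cdot> h = q (g' j)) \<longleftrightarrow> (\<forall>a\<in>A. p (g a) \<cdot> h = q a)" for h
      by (auto simp: J_def g')
    ultimately show ?thesis
      by simp
  qed
  have "L \<in> Obj C \<and> (\<forall>a\<in>A. p (g a) \<in> hom C L (F a)) \<and>
      (\<forall>(a, b)\<in>r. m a b \<cdot> p (g a) = p (g b))"
    using L unfolding is_limit_def cone by (elim conjE) (intro conjI)
  then show ?thesis
    unfolding is_preorder_limit_def
    by (intro exI[of _ L] exI[of _ "\<lambda>a. p (g a)"] conjI ballI allI impI univ) blast+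
qed

lemma ex_product:
  assumes I: "small TYPE('u) I" and F: "\<And>i. i \<in> I \<Longrightarrow> F i \<in> Obj C"
  shows "\<exists>L p. is_product C I F L p"
proof -
  let ?r = "Id_on I"
  have r: "?r \<subseteq> I \<times> I" "refl_on I ?r" "trans ?r"
    by (auto simp: refl_on_def intro: transI)
  have m: "Id C (F i) \<in> hom C (F i) (F j)" if "(i, j) \<in> ?r" for i j
    using that id_hom[OF F] by auto
  have m_comp: "Id C (F j) \<cdot> Id C (F i) = Id C (F i)" if "(i, j) \<in> ?r" "(j, k) \<in> ?r" for i j k
    using that comp_id_left[OF id_hom[OF F]] by auto
  have limit: "\<exists>L p. is_preorder_limit C I ?r F (\<lambda>i j. Id C (F i)) L p"
    by (rule preorder_limit[OF I r]) (rule F m refl m_comp; assumption)+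
  obtain L p where L: "L \<in> Obj C" "\<forall>i\<in>I. p i \<in> hom C L (F i)"
    and univ: "\<forall>Z\<in>Obj C. \<forall>q. (\<forall>i\<in>I. q i \<in> hom C Z (F i)) \<and> (\<forall>(i, j)\<in>?r. Id C (F i) \<cdot> q i = q j) \<longrightarrow>
       (\<exists>!h. h \<in> hom C Z L \<and> (\<forall>i\<in>I. p i \<cdot> h = q i))"
    using limit unfolding is_preorder_limit_def by (elim exE conjE) (rule that)
  have "\<forall>(i, j)\<in>?r. Id C (F i) \<cdot> q i = q j" if "\<forall>i\<in>I. q i \<in> hom C Z (F i)" for Z q
    using that comp_id_left by auto
  then show ?thesis
    unfolding is_product_def
    using L univ by (intro exI[of _ L] exI[of _ p]) simp
qed

text \<open>
  The diagram adds a top element \<open>None\<close>, standing for \<open>Y\<close>, to the discrete order on \<open>I\<close>. Keeping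
  \<open>Y\<close> in the diagram makes the empty wide pullback \<open>Y\<close> itself, and so the intersection of an empty
  family of subobjects the whole object.
\<close>

lemma ex_wide_pullback:
  fixes I :: "'i set"
  assumes I: "small TYPE('u) I" and Y: "Y \<in> Obj C" and m: "\<And>i. i \<in> I \<Longrightarrow> m i \<in> hom C (A i) Y"
  obtains L p q where "q \<in> hom C L Y" "\<forall>i\<in>I. p i \<in> hom C L (A i)" "\<forall>i\<in>I. m i \<cdot> p i = q"
    "\<forall>Z. \<forall>s\<in>hom C Z Y. \<forall>r. (\<forall>i\<in>I. r i \<in> hom C Z (A i)) \<and> (\<forall>i\<in>I. m i \<cdot> r i = s) \<longrightarrow>
       (\<exists>!h. h \<in> hom C Z L \<and> q \<cdot> h = s \<and> (\<forall>i\<in>I. p i \<cdot> h = r i))"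
proof -
  let ?A = "insert None (Some ` I)"
  let ?r = "Id_on ?A \<union> Some ` I \<times> {None}"
  define F where "F = case_option Y A"
  define n where "n = (\<lambda>a b. if a = b then Id C (F a) else m (the a))"
  \<comment> \<open>Subsets of \<open>I\<close> with at most one element code the index set, so \<open>Pow I\<close> bounds its size.\<close>
  have sub: "?A \<subseteq> (\<lambda>J. if J = {} then None else Some (the_elem J)) ` Pow I"
  proof
    fix a assume "a \<in> ?A"
    then show "a \<in> (\<lambda>J. if J = {} then None else Some (the_elem J)) ` Pow I"
    proof (cases a)
      case None then show ?thesis by (intro image_eqI[of _ _ "{}"]) auto
    next
      case (Some i) with \<open>a \<in> ?A\<close> show ?thesis by (intro image_eqI[of _ _ "{i}"]) auto
    qed
  qed
  have "?A \<lesssim> Pow I"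
    using sub by (rule subset_image_lepoll)
  then have small: "small TYPE('u) ?A"
    by (rule small_lepoll[OF small_Pow[OF universe I]])
  have r: "?r \<subseteq> ?A \<times> ?A" "refl_on ?A ?r" "trans ?r"
    by (auto simp: refl_on_def intro!: transI)
  have F: "F a \<in> Obj C" if "a \<in> ?A" for a
    using that Y homD(4)[OF m] by (auto simp: F_def)
  have n_id: "n a a = Id C (F a)" for a
    by (simp add: n_def)
  have n: "n a b \<in> hom C (F a) (F b)" if "(a, b) \<in> ?r" for a b
    using that id_hom[OF Y] id_hom[OF homD(4)[OF m]] m by (auto simp: n_def F_def)
  have n_comp: "n b c \<cdot> n a b = n a c" if "(a, b) \<in> ?r" "(b, c) \<in> ?r" for a b c
  proof -
    have "a = b \<or> b = c"
      using that by auto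
    then show ?thesis
      using comp_id_left[OF n[OF that(1)]] comp_id_right[OF n[OF that(2)]] by (auto simp: n_id)
  qed
  have limit: "\<exists>L p. is_preorder_limit C ?A ?r F n L p"
    by (rule preorder_limit[OF small r]) (rule F n n_id n_comp; assumption)+
  obtain L p where L: "\<forall>a\<in>?A. p a \<in> hom C L (F a)" "\<forall>(a, b)\<in>?r. n a b \<cdot> p a = p b"
    and univ: "\<forall>Z\<in>Obj C. \<forall>q. (\<forall>a\<in>?A. q a \<in> hom C Z (F a)) \<and> (\<forall>(a, b)\<in>?r. n a b \<cdot> q a = q b) \<longrightarrow>
       (\<exists>!h. h \<in> hom C Z L \<and> (\<forall>a\<in>?A. p a \<cdot> h = q a))"
    using limit unfolding is_preorder_limit_def by (elim exE conjE) (rule that)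
  show thesis
  proof (rule that[of "p None" L "\<lambda>i. p (Some i)"])
    show "p None \<in> hom C L Y" "\<forall>i\<in>I. p (Some i) \<in> hom C L (A i)"
      using L(1) by (auto simp: F_def)
    have "m i \<cdot> p (Some i) = p None" if "i \<in> I" for i
      using bspec[OF L(2), of "(Some i, None)"] that by (simp add: n_def)
    then show "\<forall>i\<in>I. m i \<cdot> p (Some i) = p None"
      by blast
  next
    have "\<exists>!h. h \<in> hom C Z L \<and> p None \<cdot> h = s \<and> (\<forall>i\<in>I. p (Some i) \<cdot> h = r i)"
      if s: "s \<in> hom C Z Y" and r: "\<And>i. i \<in> I \<Longrightarrow> r i \<in> hom C Z (A i)"
        and eq: "\<And>i. i \<in> I \<Longrightarrow> m i \<cdot> r i = s" for Z s r
    proof -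
      let ?q = "case_option s r"
      have "\<exists>!h. h \<in> hom C Z L \<and> (\<forall>a\<in>?A. p a \<cdot> h = ?q a)"
      proof (intro univ[rule_format] conjI ballI)
        show "Z \<in> Obj C" using homD(4)[OF s] .
        show "?q a \<in> hom C Z (F a)" if "a \<in> ?A" for a
          using that s r by (auto simp: F_def)
        show "case e of (a, b) \<Rightarrow> n a b \<cdot> ?q a = ?q b" if "e \<in> ?r" for e
          using that comp_id_left[OF s] comp_id_left[OF r] eq by (auto simp: n_def F_def)
      qed
      then show ?thesis
        by simp
    qed
    then show "\<forall>Z. \<forall>s\<in>hom C Z Y. \<forall>r. (\<forall>i\<in>I. r i \<in> hom C Z (A i)) \<and> (\<forall>i\<in>I. m i \<cdot> r i = s) \<longrightarrow>
       (\<exists>!h. h \<in> hom C Z L \<and> p None \<cdot> h = s \<and> (\<forall>i\<in>I. p (Some i) \<cdot> h = r i))"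
      by (intro allI ballI impI) (elim conjE, blast)
  qed
qed

lemma ex_pullback:
  assumes f: "f \<in> hom C A Y" and g: "g \<in> hom C B Y"
  obtains L p q where "is_pullback C f g L p q"
proof -
  have fg: "case_bool f g b \<in> hom C (case_bool A B b) Y" for b
    using f g by (simp split: bool.split)
  obtain L p y where L: "y \<in> hom C L Y" "\<forall>b\<in>UNIV. p b \<in> hom C L (case_bool A B b)"
    "\<forall>b\<in>UNIV. case_bool f g b \<cdot> p b = y"
    and univ: "\<forall>Z. \<forall>s\<in>hom C Z Y. \<forall>r. (\<forall>b\<in>UNIV. r b \<in> hom C Z (case_bool A B b)) \<and>
       (\<forall>b\<in>UNIV. case_bool f g b \<cdot> r b = s) \<longrightarrow>
       (\<exists>!h. h \<in> hom C Z L \<and> y \<cdot> h = s \<and> (\<forall>b\<in>UNIV. p b \<cdot> h = r b))"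
    using ex_wide_pullback[of UNIV Y "case_bool f g" "case_bool A B",
        OF small_finite[OF finite_UNIV] homD(5)[OF f] fg] .
  have p: "p True \<in> hom C L A" "p False \<in> hom C L B" "f \<cdot> p True = y" "g \<cdot> p False = y"
    using bspec[OF L(2), of True] bspec[OF L(2), of False]
      bspec[OF L(3), of True] bspec[OF L(3), of False] by simp_all
  have "\<exists>!h. h \<in> hom C Z L \<and> p True \<cdot> h = r \<and> p False \<cdot> h = s"
    if rs: "r \<in> hom C Z A" "s \<in> hom C Z B" "f \<cdot> r = g \<cdot> s" for Z r s
  proof -
    have "\<exists>!h. h \<in> hom C Z L \<and> y \<cdot> h = f \<cdot> r \<and> (\<forall>b\<in>UNIV. p b \<cdot> h = case_bool r s b)"
      by (rule univ[rule_format]) (use rs comp_hom[OF rs(1) f] in \<open>auto split: bool.split\<close>)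
    moreover have "y \<cdot> h = f \<cdot> r" if "h \<in> hom C Z L" "p True \<cdot> h = r" for h
      using comp_assoc[OF that(1) p(1) f] p(3) that(2) by simp
    ultimately show ?thesis
      by (auto simp: all_bool_eq)
  qed
  then have "is_pullback C f g L (p True) (p False)"
    unfolding is_pullback_def using p homD(2)[OF f] homD(2)[OF g] by simp
  then show thesis by (rule that)
qed

section \<open>Arrows into products\<close>

lemma is_product_obj:
  assumes "small TYPE('u) I" "\<And>i. i \<in> I \<Longrightarrow> F i \<in> Obj C"
  shows "is_product C I F (product_obj C I F) (pr C I F)"
proof -
  have "\<exists>Lp. is_product C I F (fst Lp) (snd Lp)"
    using ex_product[OF assms] by auto
  then show ?thesis
    unfolding product_obj_def pr_def product_cone_def by (rule someI_ex)
qed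

context
  fixes I :: "'i set" and F
  assumes I: "small TYPE('u) I" and F: "\<And>i. i \<in> I \<Longrightarrow> F i \<in> Obj C"
begin

lemma is_product: "is_product C I F (product_obj C I F) (pr C I F)"
  using is_product_obj[of I F] I F by blast

lemma product_obj: "product_obj C I F \<in> Obj C"
  using is_product by (simp add: is_product_def)

lemma pr_hom: "i \<in> I \<Longrightarrow> pr C I F i \<in> hom C (product_obj C I F) (F i)"
  using is_product by (simp add: is_product_def)

lemma product_universal:
  assumes "Z \<in> Obj C" "\<And>i. i \<in> I \<Longrightarrow> q i \<in> hom C Z (F i)"
  shows "\<exists>!h. h \<in> hom C Z (product_obj C I F) \<and> (\<forall>i\<in>I. pr C I F i \<cdot> h = q i)"
proof -
  have "\<forall>Z\<in>Obj C. \<forall>q. (\<forall>i\<in>I. q i \<in> hom C Z (F i)) \<longrightarrow>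
      (\<exists>!h. h \<in> hom C Z (product_obj C I F) \<and> (\<forall>i\<in>I. pr C I F i \<cdot> h = q i))"
    using is_product unfolding is_product_def by (elim conjE)
  from this[rule_format, OF assms] show ?thesis .
qed

lemma product_eqI:
  assumes g: "g \<in> hom C Z (product_obj C I F)" and h: "h \<in> hom C Z (product_obj C I F)"
    and eq: "\<And>i. i \<in> I \<Longrightarrow> pr C I F i \<cdot> g = pr C I F i \<cdot> h"
  shows "g = h"
proof -
  have "\<exists>!k. k \<in> hom C Z (product_obj C I F) \<and> (\<forall>i\<in>I. pr C I F i \<cdot> k = pr C I F i \<cdot> h)"
    by (rule product_universal[OF homD(4)[OF h] comp_hom[OF h pr_hom]])
  then show ?thesis
    by (rule ex1E) (use g h eq in metis)
qed

lemma tuple: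
  assumes Z: "Z \<in> Obj C" and q: "\<And>i. i \<in> I \<Longrightarrow> q i \<in> hom C Z (F i)"
  shows tuple_hom: "tuple C I F Z q \<in> hom C Z (product_obj C I F)"
    and pr_tuple: "i \<in> I \<Longrightarrow> pr C I F i \<cdot> tuple C I F Z q = q i"
proof -
  from theI'[OF product_universal[of Z q, OF Z q]] show "tuple C I F Z q \<in> hom C Z (product_obj C I F)"
    "i \<in> I \<Longrightarrow> pr C I F i \<cdot> tuple C I F Z q = q i"
    unfolding tuple_def by blast+
qed

lemma tuple_comp:
  assumes k: "k \<in> hom C Z' Z" and q: "\<And>i. i \<in> I \<Longrightarrow> q i \<in> hom C Z (F i)"
  shows "tuple C I F Z q \<cdot> k = tuple C I F Z' (\<lambda>i. q i \<cdot> k)"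
proof (rule product_eqI)
  have t: "tuple C I F Z q \<in> hom C Z (product_obj C I F)"
    using q by (rule tuple_hom[OF homD(5)[OF k]])
  show "tuple C I F Z q \<cdot> k \<in> hom C Z' (product_obj C I F)"
    using comp_hom[OF k t] .
  have qk: "q i \<cdot> k \<in> hom C Z' (F i)" if "i \<in> I" for i
    using comp_hom[OF k q[OF that]] .
  show "tuple C I F Z' (\<lambda>i. q i \<cdot> k) \<in> hom C Z' (product_obj C I F)"
    using qk by (rule tuple_hom[OF homD(4)[OF k]])
  show "pr C I F i \<cdot> (tuple C I F Z q \<cdot> k) = pr C I F i \<cdot> tuple C I F Z' (\<lambda>i. q i \<cdot> k)"
    if "i \<in> I" for i
    using comp_assoc[OF k t pr_hom[OF that]] pr_tuple[OF homD(5)[OF k] q that]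
      pr_tuple[OF homD(4)[OF k] qk that] by simp
qed

lemma product_map:
  assumes G: "\<And>i. i \<in> I \<Longrightarrow> G i \<in> Obj C" and f: "\<And>i. i \<in> I \<Longrightarrow> f i \<in> hom C (F i) (G i)"
  shows product_map_hom: "product_map C I F G f \<in> hom C (product_obj C I F) (product_obj C I G)"
    and pr_product_map:
      "i \<in> I \<Longrightarrow> pr C I G i \<cdot> product_map C I F G f = f i \<cdot> pr C I F i"
  unfolding product_map_def
  using small_complete_category.tuple[OF small_complete_category_axioms I, of G
      "product_obj C I F" "\<lambda>i. f i \<cdot> pr C I F i"] G product_obj comp_hom[OF pr_hom f]
  by blast+

end

lemma tuple_cong:
  assumes "\<And>i. i \<in> I \<Longrightarrow> q i = q' i"
  shows "tuple C I F Z q = tuple C I F Z q'"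
  using assms by (simp add: tuple_def cong: ball_cong)

context
  fixes A B
  assumes A: "A \<in> Obj C" and B: "B \<in> Obj C"
begin

lemma bin_factors: "case_bool A B b \<in> Obj C" "small TYPE('u) (UNIV :: bool set)"
  using A B by (auto simp: small_finite split: bool.split)

lemma bin_product_obj: "bin_product C A B \<in> Obj C"
  unfolding bin_product_def by (rule product_obj[of UNIV "case_bool A B", OF bin_factors(2,1)])

lemma pr12_hom: "pr1 C A B \<in> hom C (bin_product C A B) A" "pr2 C A B \<in> hom C (bin_product C A B) B"
  unfolding bin_product_def pr1_def pr2_def
  using pr_hom[of UNIV "case_bool A B", OF bin_factors(2,1), of True] pr_hom[of UNIV "case_bool A B", OF bin_factors(2,1), of False] by simp_all

lemma pair:
  assumes "a \<in> hom C Z A" "b \<in> hom C Z B"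
  shows pair_hom: "pair C A B Z a b \<in> hom C Z (bin_product C A B)"
    and pr1_pair: "pr1 C A B \<cdot> pair C A B Z a b = a"
    and pr2_pair: "pr2 C A B \<cdot> pair C A B Z a b = b"
proof -
  have q: "case_bool a b i \<in> hom C Z (case_bool A B i)" for i
    using assms by (simp split: bool.split)
  note t = tuple[of UNIV "case_bool A B" Z "case_bool a b", OF bin_factors(2,1) homD(4)[OF assms(1)] q]
  show "pair C A B Z a b \<in> hom C Z (bin_product C A B)"
    unfolding bin_product_def pair_def by (rule t(1))
  show "pr1 C A B \<cdot> pair C A B Z a b = a" "pr2 C A B \<cdot> pair C A B Z a b = b"
    unfolding pr1_def pr2_def pair_def using t(2)[of True] t(2)[of False] by simp_all
qed

lemma bin_product_eqI:
  assumes "g \<in> hom C Z (bin_product C A B)" "h \<in> hom C Z (bin_product C A B)"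
    and "pr1 C A B \<cdot> g = pr1 C A B \<cdot> h" "pr2 C A B \<cdot> g = pr2 C A B \<cdot> h"
  shows "g = h"
proof (rule product_eqI[of UNIV "case_bool A B", OF bin_factors(2,1)])
  show "g \<in> hom C Z (product_obj C UNIV (case_bool A B))"
    "h \<in> hom C Z (product_obj C UNIV (case_bool A B))"
    using assms(1,2) by (simp_all add: bin_product_def)
  show "pr C UNIV (case_bool A B) i \<cdot> g = pr C UNIV (case_bool A B) i \<cdot> h" for i
    using assms(3,4) by (cases i) (simp_all add: pr1_def pr2_def)
qed

lemma pair_comp:
  assumes a: "a \<in> hom C Z A" and b: "b \<in> hom C Z B" and k: "k \<in> hom C Z' Z"
  shows "pair C A B Z a b \<cdot> k = pair C A B Z' (a \<cdot> k) (b \<cdot> k)"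
proof (rule bin_product_eqI)
  note ak = comp_hom[OF k a] and bk = comp_hom[OF k b]
  show "pair C A B Z a b \<cdot> k \<in> hom C Z' (bin_product C A B)"
    using comp_hom[OF k pair_hom[OF a b]] .
  show "pair C A B Z' (a \<cdot> k) (b \<cdot> k) \<in> hom C Z' (bin_product C A B)"
    using pair_hom[OF ak bk] .
  show "pr1 C A B \<cdot> (pair C A B Z a b \<cdot> k) = pr1 C A B \<cdot> pair C A B Z' (a \<cdot> k) (b \<cdot> k)"
    using comp_assoc[OF k pair_hom[OF a b] pr12_hom(1)] pr1_pair[OF a b] pr1_pair[OF ak bk] by simp
  show "pr2 C A B \<cdot> (pair C A B Z a b \<cdot> k) = pr2 C A B \<cdot> pair C A B Z' (a \<cdot> k) (b \<cdot> k)"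
    using comp_assoc[OF k pair_hom[OF a b] pr12_hom(2)] pr2_pair[OF a b] pr2_pair[OF ak bk] by simp
qed

end

lemma times_map:
  assumes f: "f \<in> hom C A A'" and g: "g \<in> hom C B B'"
  shows times_map_hom: "times_map C f g \<in> hom C (bin_product C A B) (bin_product C A' B')"
    and times_map_pair: "a \<in> hom C Z A \<Longrightarrow> b \<in> hom C Z B \<Longrightarrow>
      times_map C f g \<cdot> pair C A B Z a b = pair C A' B' Z (f \<cdot> a) (g \<cdot> b)"
proof -
  note p = pr12_hom[OF homD(4)[OF f] homD(4)[OF g]]
  note fp = comp_hom[OF p(1) f] and gp = comp_hom[OF p(2) g]
  have eq: "times_map C f g =
      pair C A' B' (bin_product C A B) (f \<cdot> pr1 C A B) (g \<cdot> pr2 C A B)"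
    using f g by (simp add: times_map_def Let_def hom_def)
  show "times_map C f g \<in> hom C (bin_product C A B) (bin_product C A' B')"
    unfolding eq by (rule pair_hom[OF homD(5)[OF f] homD(5)[OF g] fp gp])
  assume a: "a \<in> hom C Z A" and b: "b \<in> hom C Z B"
  note ab = pair[OF homD(4)[OF f] homD(4)[OF g] a b]
  show "times_map C f g \<cdot> pair C A B Z a b = pair C A' B' Z (f \<cdot> a) (g \<cdot> b)"
    unfolding eq pair_comp[OF homD(5)[OF f] homD(5)[OF g] fp gp ab(1)]
      comp_assoc[OF ab(1) p(1) f] comp_assoc[OF ab(1) p(2) g] ab(2,3) ..
qed

lemma product_map_tuple:
  assumes I: "small TYPE('u) I" and f: "\<And>i. i \<in> I \<Longrightarrow> f i \<in> hom C (F i) (G i)"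
    and Z: "Z \<in> Obj C" and q: "\<And>i. i \<in> I \<Longrightarrow> q i \<in> hom C Z (F i)"
  shows "product_map C I F G f \<cdot> tuple C I F Z q = tuple C I G Z (\<lambda>i. f i \<cdot> q i)"
proof -
  have F: "F i \<in> Obj C" and G: "G i \<in> Obj C" if "i \<in> I" for i
    using homD(4,5)[OF f[OF that]] .
  note p = pr_hom[of I F, OF I F]
  have t: "tuple C I F Z q \<in> hom C Z (product_obj C I F)"
    "\<And>i. i \<in> I \<Longrightarrow> pr C I F i \<cdot> tuple C I F Z q = q i"
    using tuple[of I F Z q] I F Z q by blast+
  have "product_map C I F G f \<cdot> tuple C I F Z q =
      tuple C I G Z (\<lambda>i. (f i \<cdot> pr C I F i) \<cdot> tuple C I F Z q)"
    unfolding product_map_def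
    by (rule tuple_comp) (use I G t comp_hom[OF p f] in blast)+
  also have "\<dots> = tuple C I G Z (\<lambda>i. f i \<cdot> q i)"
    by (rule tuple_cong) (use comp_assoc[OF t(1) p f] t(2) in auto)
  finally show ?thesis .
qed

end


section \<open>Convergence of nets of generalized elements\<close>

definition pointed_net ::
  "('o, 'a) cat \<Rightarrow> 'o \<Rightarrow> 'b rel \<Rightarrow> 'o \<Rightarrow> ('b \<Rightarrow> 'a) \<Rightarrow> 'a \<Rightarrow> bool" where
  "pointed_net C X P Z x l \<longleftrightarrow> (\<forall>p\<in>Field P. x p \<in> hom C Z X) \<and> l \<in> hom C Z X"

definition net_arr ::
  "('o, 'a) cat \<Rightarrow> 'o \<Rightarrow> 'b rel \<Rightarrow> 'o \<Rightarrow> ('b \<Rightarrow> 'a) \<Rightarrow> 'a \<Rightarrow> 'a" where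
  "net_arr C X P Z x l = pair C (power_obj C X P) X Z (tuple C (Field P) (\<lambda>_. X) Z x) l"

text \<open>
  Typing is made part of convergence, so that a convergent net can be used without restating where
  its members and its limit live.
\<close>

definition converges ::
  "('o, 'a) cat \<Rightarrow> 'o \<Rightarrow> ('b rel \<Rightarrow> 'a) \<Rightarrow> 'b rel \<Rightarrow> 'o \<Rightarrow> ('b \<Rightarrow> 'a) \<Rightarrow> 'a \<Rightarrow> bool" where
  "converges C X T P Z x l \<longleftrightarrow>
     pointed_net C X P Z x l \<and> factors_through C (net_arr C X P Z x l) (T P)"

lemma net_arr_cong:
  "(\<And>p. p \<in> Field P \<Longrightarrow> x p = x' p) \<Longrightarrow> net_arr C X P Z x l = net_arr C X P Z x' l"
  by (simp add: net_arr_def tuple_def cong: ball_cong)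

lemma converges_cong:
  "(\<And>p. p \<in> Field P \<Longrightarrow> x p = x' p) \<Longrightarrow> converges C X T P Z x l \<longleftrightarrow> converges C X T P Z x' l"
  by (simp add: converges_def pointed_net_def net_arr_cong[of P x x'])

lemma small_Field: "P \<in> dirsets \<Longrightarrow> small TYPE('u) (Field (P :: 'u rel))"
  by (simp add: dirsets_def)

context small_complete_category
begin

context
  fixes X and P :: "'u rel"
  assumes X: "X \<in> Obj C" and P: "P \<in> dirsets"
begin

lemma power_obj: "power_obj C X P \<in> Obj C"
  unfolding power_obj_def by (rule product_obj[OF small_Field[OF P] X])

lemma proj_at_hom: "p \<in> Field P \<Longrightarrow> proj_at C X P p \<in> hom C (power_obj C X P) X"
  unfolding power_obj_def proj_at_def by (rule pr_hom[OF small_Field[OF P] X])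

lemma power_tuple:
  assumes "pointed_net C X P Z x l"
  shows "tuple C (Field P) (\<lambda>_. X) Z x \<in> hom C Z (power_obj C X P)"
    "p \<in> Field P \<Longrightarrow> proj_at C X P p \<cdot> tuple C (Field P) (\<lambda>_. X) Z x = x p"
  using assms tuple[of "Field P" "\<lambda>_. X" Z x] small_Field[OF P] X homD(4)[of l]
  by (auto simp: pointed_net_def power_obj_def proj_at_def)

lemma netlim_obj: "netlim C X P \<in> Obj C"
  unfolding netlim_def by (rule bin_product_obj[OF power_obj X])

lemma net_arr_hom:
  assumes "pointed_net C X P Z x l"
  shows "net_arr C X P Z x l \<in> hom C Z (netlim C X P)"
  unfolding net_arr_def netlim_def
  using assms power_tuple(1)[OF assms] pair_hom[OF power_obj X] by (simp add: pointed_net_def)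

lemma net_arr_pr:
  assumes "pointed_net C X P Z x l"
  shows "pr1 C (power_obj C X P) X \<cdot> net_arr C X P Z x l = tuple C (Field P) (\<lambda>_. X) Z x"
    "pr2 C (power_obj C X P) X \<cdot> net_arr C X P Z x l = l"
  unfolding net_arr_def
  using assms power_tuple(1)[OF assms] pr1_pair[OF power_obj X] pr2_pair[OF power_obj X]
  by (simp_all add: pointed_net_def)

lemma pointed_net_comp:
  assumes "pointed_net C X P Z x l" "k \<in> hom C Z' Z"
  shows "pointed_net C X P Z' (\<lambda>p. x p \<cdot> k) (l \<cdot> k)"
  using assms comp_hom[OF assms(2)] by (simp add: pointed_net_def)

lemma net_arr_comp:
  assumes x: "pointed_net C X P Z x l" and k: "k \<in> hom C Z' Z"
  shows "net_arr C X P Z x l \<cdot> k = net_arr C X P Z' (\<lambda>p. x p \<cdot> k) (l \<cdot> k)"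
proof -
  have "net_arr C X P Z x l \<cdot> k =
      pair C (power_obj C X P) X Z' (tuple C (Field P) (\<lambda>_. X) Z x \<cdot> k) (l \<cdot> k)"
    unfolding net_arr_def
    by (rule pair_comp[OF power_obj X power_tuple(1)[OF x] _ k]) (use x in \<open>simp add: pointed_net_def\<close>)
  also have "tuple C (Field P) (\<lambda>_. X) Z x \<cdot> k = tuple C (Field P) (\<lambda>_. X) Z' (\<lambda>p. x p \<cdot> k)"
    by (rule tuple_comp[OF small_Field[OF P] X k]) (use x in \<open>simp add: pointed_net_def\<close>)
  finally show ?thesis
    unfolding net_arr_def .
qed

lemma net_arr_cases:
  assumes g: "g \<in> hom C Z (netlim C X P)"
  defines "x \<equiv> \<lambda>p. proj_at C X P p \<cdot> pr1 C (power_obj C X P) X \<cdot> g"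
    and "l \<equiv> pr2 C (power_obj C X P) X \<cdot> g"
  shows "pointed_net C X P Z x l" "g = net_arr C X P Z x l"
proof -
  note p = pr12_hom[OF power_obj X]
  have g': "g \<in> hom C Z (bin_product C (power_obj C X P) X)"
    using g by (simp add: netlim_def)
  note pg = comp_hom[OF g' p(1)]
  show x: "pointed_net C X P Z x l"
    using comp_hom[OF pg proj_at_hom] comp_hom[OF g' p(2)]
    by (simp add: pointed_net_def x_def l_def)
  have "pr1 C (power_obj C X P) X \<cdot> g = tuple C (Field P) (\<lambda>_. X) Z x"
  proof (rule product_eqI[OF small_Field[OF P] X])
    show "pr1 C (power_obj C X P) X \<cdot> g \<in> hom C Z (product_obj C (Field P) (\<lambda>_. X))"
      "tuple C (Field P) (\<lambda>_. X) Z x \<in> hom C Z (product_obj C (Field P) (\<lambda>_. X))"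
      using pg power_tuple(1)[OF x] by (simp_all add: power_obj_def)
    show "pr C (Field P) (\<lambda>_. X) i \<cdot> pr1 C (power_obj C X P) X \<cdot> g =
        pr C (Field P) (\<lambda>_. X) i \<cdot> tuple C (Field P) (\<lambda>_. X) Z x" if "i \<in> Field P" for i
      using power_tuple(2)[OF x that] by (simp add: x_def proj_at_def)
  qed
  then show "g = net_arr C X P Z x l"
    using net_arr_pr[OF x] net_arr_hom[OF x] g
    by - (rule bin_product_eqI[OF power_obj X], simp_all add: netlim_def l_def)
qed

end

lemma reindex_net_arr:
  fixes P Q :: "'u rel"
  assumes X: "X \<in> Obj C" and P: "P \<in> dirsets" and Q: "Q \<in> dirsets" and h: "h ` Field Q \<subseteq> Field P"
  shows times_reindex_hom:
      "times_map C (reindex C X P Q h) (Id C X) \<in> hom C (netlim C X P) (netlim C X Q)"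
    and times_reindex_net_arr: "pointed_net C X P Z x l \<Longrightarrow>
      times_map C (reindex C X P Q h) (Id C X) \<cdot> net_arr C X P Z x l =
        net_arr C X Q Z (\<lambda>q. x (h q)) l"
proof -
  have hq: "h q \<in> Field P" if "q \<in> Field Q" for q
    using h that by blast
  note proj = proj_at_hom[OF X P hq]
  have r: "reindex C X P Q h \<in> hom C (power_obj C X P) (power_obj C X Q)"
    unfolding reindex_def power_obj_def[of C X Q]
    by (rule tuple_hom[OF small_Field[OF Q] X power_obj[OF X P] proj])
  show "times_map C (reindex C X P Q h) (Id C X) \<in> hom C (netlim C X P) (netlim C X Q)"
    unfolding netlim_def by (rule times_map_hom[OF r id_hom[OF X]])
  assume x: "pointed_net C X P Z x l"
  then have l: "l \<in> hom C Z X" by (simp add: pointed_net_def)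
  note t = power_tuple[OF X P x]
  have "reindex C X P Q h \<cdot> tuple C (Field P) (\<lambda>_. X) Z x = tuple C (Field Q) (\<lambda>_. X) Z
      (\<lambda>q. proj_at C X P (h q) \<cdot> tuple C (Field P) (\<lambda>_. X) Z x)"
    unfolding reindex_def by (rule tuple_comp[OF small_Field[OF Q] X t(1) proj])
  also have "\<dots> = tuple C (Field Q) (\<lambda>_. X) Z (\<lambda>q. x (h q))"
    by (rule tuple_cong) (simp add: t(2) hq)
  finally show "times_map C (reindex C X P Q h) (Id C X) \<cdot> net_arr C X P Z x l =
      net_arr C X Q Z (\<lambda>q. x (h q)) l"
    unfolding net_arr_def times_map_pair[OF r id_hom[OF X] t(1) l] comp_id_left[OF l] by simp
qed

lemma power_map_net_arr:
  fixes P :: "'u rel"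
  assumes f: "f \<in> hom C X Y" and P: "P \<in> dirsets"
  shows times_power_map_hom: "times_map C (power_map C P f) f \<in> hom C (netlim C X P) (netlim C Y P)"
    and times_power_map_net_arr: "pointed_net C X P Z x l \<Longrightarrow>
      times_map C (power_map C P f) f \<cdot> net_arr C X P Z x l =
        net_arr C Y P Z (\<lambda>p. f \<cdot> x p) (f \<cdot> l)"
proof -
  note X = homD(4)[OF f] and Y = homD(5)[OF f]
  have eq: "power_map C P f = product_map C (Field P) (\<lambda>_. X) (\<lambda>_. Y) (\<lambda>_. f)"
    using homD[OF f] by (simp add: power_map_def)
  have r: "power_map C P f \<in> hom C (power_obj C X P) (power_obj C Y P)"
    unfolding eq power_obj_def
    by (rule product_map_hom[of _ "\<lambda>_. X" "\<lambda>_. Y" "\<lambda>_. f", OF small_Field[OF P] X Y f])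
  show "times_map C (power_map C P f) f \<in> hom C (netlim C X P) (netlim C Y P)"
    unfolding netlim_def by (rule times_map_hom[OF r f])
  assume x: "pointed_net C X P Z x l"
  then have l: "l \<in> hom C Z X" and x': "\<And>p. p \<in> Field P \<Longrightarrow> x p \<in> hom C Z X"
    by (simp_all add: pointed_net_def)
  have "power_map C P f \<cdot> tuple C (Field P) (\<lambda>_. X) Z x = tuple C (Field P) (\<lambda>_. Y) Z (\<lambda>p. f \<cdot> x p)"
    unfolding eq by (rule product_map_tuple[OF small_Field[OF P] f homD(4)[OF l] x'])
  then show "times_map C (power_map C P f) f \<cdot> net_arr C X P Z x l =
      net_arr C Y P Z (\<lambda>p. f \<cdot> x p) (f \<cdot> l)"
    unfolding net_arr_def times_map_pair[OF r f power_tuple(1)[OF X P x] l] by simp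
qed

end

section \<open>The axioms in terms of generalized elements\<close>

lemma (in small_complete_category) small_cofinal_subsets:
  assumes "P \<in> dirsets"
  shows "small TYPE('u) (cofinal_subsets (P :: 'u rel))"
  by (rule small_inj[OF small_Pow[OF universe small_Field[OF assms]], of id])
    (auto simp: cofinal_subsets_def)

lemma cofinal_map_Restr: "cofinal_map R (Restr P Q) h \<Longrightarrow> h ` Field R \<subseteq> Field P"
  using mono_Field[of "Restr P Q" P] by (auto simp: cofinal_map_def)

lemma order_iso_iteration_order:
  fixes P :: "'u rel" and Q :: "'u \<Rightarrow> 'u rel"
  assumes "P \<in> dirsets" "\<forall>p\<in>Field P. Q p \<in> dirsets"
    and "order_iso R (iteration_order P Q) e" "r \<in> Field R"
  shows "fst (e r) \<in> Field P" "snd (e r) (fst (e r)) \<in> Field (Q (fst (e r)))"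
proof -
  have "Field (iteration_order P Q) = Field P \<times> (\<Pi>\<^sub>E p\<in>Field P. Field (Q p))"
    using directed_iteration_order[of P Q] assms(1,2) by (simp add: dirsets_def)
  then have "e r \<in> Field P \<times> (\<Pi>\<^sub>E p\<in>Field P. Field (Q p))"
    using assms(3,4) by (auto simp: order_iso_def dest: bij_betwE)
  then show "fst (e r) \<in> Field P" "snd (e r) (fst (e r)) \<in> Field (Q (fst (e r)))"
    by (auto simp: mem_Times_iff dest: PiE_mem)
qed

text \<open>
  The setting shared by topologies and by a family that is about to be shown to be one: an arrow into
  \<open>X\<^sup>P \<times> X\<close> for each \<open>P\<close>.
\<close>

locale convergence_structure = small_complete_category C univ
  for C :: "('o, 'a) cat" (structure) and univ :: "'u itself" +
  fixes X :: 'o and T :: "'u rel \<Rightarrow> 'a"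
  assumes X: "X \<in> Obj C"
    and T_hom: "P \<in> dirsets \<Longrightarrow> T P \<in> hom C (Dom C (T P)) (netlim C X P)"
begin

lemma converges_iff_lift:
  assumes "P \<in> dirsets" "pointed_net C X P Z x l"
  shows "converges C X T P Z x l \<longleftrightarrow>
    (\<exists>k\<in>hom C Z (Dom C (T P)). T P \<cdot> k = net_arr C X P Z x l)"
  using assms factors_through_hom_iff[OF net_arr_hom[OF X assms]] by (simp add: converges_def)

lemma converges_comp:
  assumes P: "P \<in> dirsets" and x: "converges C X T P Z x l" and k: "k \<in> hom C Z' Z"
  shows "converges C X T P Z' (\<lambda>p. x p \<cdot> k) (l \<cdot> k)"
proof -
  have pn: "pointed_net C X P Z x l"
    using x by (simp add: converges_def)
  have "factors_through C (net_arr C X P Z x l \<cdot> k) (T P)"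
    using x factors_through_comp[OF _ T_hom[OF P] net_arr_hom[OF X P pn] k]
    by (simp add: converges_def)
  then show ?thesis
    using pointed_net_comp[OF X P pn k] net_arr_comp[OF X P pn k] by (simp add: converges_def)
qed

lemma net_of_hom:
  assumes P: "P \<in> dirsets"
  shows "net_of C X T P \<in> hom C (Dom C (T P)) (power_obj C X P)"
    and "lim_of C X T P \<in> hom C (Dom C (T P)) X"
  using pr12_hom[OF power_obj[OF X P] X] comp_hom[OF T_hom[OF P, unfolded netlim_def]]
  by (auto simp: net_of_def lim_of_def)

text \<open>
  The generic convergent net: \<open>\<iota>\<^sub>P\<close>, seen as a generalized element of \<open>X\<^sup>P \<times> X\<close> with stage
  \<open>C(P, X)\<close>. All other convergent nets arise from it by composition.
\<close>

lemma universal_net: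
  assumes P: "P \<in> dirsets"
  shows "T P = net_arr C X P (Dom C (T P)) (\<lambda>p. proj_at C X P p \<cdot> net_of C X T P) (lim_of C X T P)"
    and "converges C X T P (Dom C (T P)) (\<lambda>p. proj_at C X P p \<cdot> net_of C X T P) (lim_of C X T P)"
proof -
  note u = net_arr_cases[OF X P T_hom[OF P], folded net_of_def lim_of_def]
  show "T P = net_arr C X P (Dom C (T P)) (\<lambda>p. proj_at C X P p \<cdot> net_of C X T P) (lim_of C X T P)"
    by (rule u(2))
  have "factors_through C (T P) (T P)"
    using T_hom[OF P] id_hom[OF homD(4)[OF T_hom[OF P]]] comp_id_right
    by (auto simp: factors_through_def)
  then show "converges C X T P (Dom C (T P))
      (\<lambda>p. proj_at C X P p \<cdot> net_of C X T P) (lim_of C X T P)"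
    using u by (simp add: converges_def)
qed

lemma net_of_lift:
  assumes P: "P \<in> dirsets" and x: "pointed_net C X P Z x l"
    and k: "k \<in> hom C Z (Dom C (T P))" "T P \<cdot> k = net_arr C X P Z x l"
  shows "net_of C X T P \<cdot> k = tuple C (Field P) (\<lambda>_. X) Z x" "lim_of C X T P \<cdot> k = l"
  using comp_assoc[OF k(1) T_hom[OF P, unfolded netlim_def]] pr12_hom[OF power_obj[OF X P] X]
    net_arr_pr[OF X P x] k(2)
  by (simp_all add: net_of_def lim_of_def)

text \<open>
  Each axiom is equivalent to its version for generalized elements. To obtain the axiom, it suffices to
  look at the universal element of the object at hand (the domain of \<open>\<iota>\<^sub>P\<close> or a fiber product).
  Conversely, a generalized element is a composite of the universal one with an arrow, and composition
  preserves factorizations.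
\<close>

lemma constant_netsI:
  assumes "\<And>P Z x. P \<in> dirsets \<Longrightarrow> x \<in> hom C Z X \<Longrightarrow> converges C X T P Z (\<lambda>_. x) x"
  shows "constant_nets C X T"
  using assms[OF _ id_hom[OF X]] by (simp add: constant_nets_def converges_def net_arr_def)

lemma constant_netsD:
  assumes "constant_nets C X T" and P: "P \<in> dirsets" and x: "x \<in> hom C Z X"
  shows "converges C X T P Z (\<lambda>_. x) x"
proof -
  have "converges C X T P X (\<lambda>_. Id C X) (Id C X)"
    using assms(1) P id_hom[OF X]
    by (simp add: constant_nets_def converges_def net_arr_def pointed_net_def)
  from converges_comp[OF P this x] show ?thesis
    using comp_id_left[OF x] by simp
qed

lemma subnetsI:
  assumes "\<And>P Q h Z x l. P \<in> dirsets \<Longrightarrow> Q \<in> dirsets \<Longrightarrow> cofinal_map Q P h \<Longrightarrow>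
    converges C X T P Z x l \<Longrightarrow> converges C X T Q Z (\<lambda>q. x (h q)) l"
  shows "subnets C X T"
  unfolding subnets_def
proof (intro ballI allI impI)
  fix P Q :: "'u rel" and h
  assume P: "P \<in> dirsets" and Q: "Q \<in> dirsets" and h: "cofinal_map Q P h"
  then have h': "h ` Field Q \<subseteq> Field P"
    by (simp add: cofinal_map_def)
  note u = universal_net[OF P]
  have "factors_through C (times_map C (reindex C X P Q h) (Id C X) \<cdot>
      net_arr C X P (Dom C (T P)) (\<lambda>p. proj_at C X P p \<cdot> net_of C X T P) (lim_of C X T P)) (T Q)"
    using assms[OF P Q h u(2)] u(2) times_reindex_net_arr[OF X P Q h'] by (simp add: converges_def)
  then show "factors_through C (times_map C (reindex C X P Q h) (Id C X) \<cdot> T P) (T Q)"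
    unfolding u(1)[symmetric] .
qed

lemma subnetsD:
  assumes "subnets C X T" and P: "P \<in> dirsets" and Q: "Q \<in> dirsets" and h: "cofinal_map Q P h"
    and x: "converges C X T P Z x l"
  shows "converges C X T Q Z (\<lambda>q. x (h q)) l"
proof -
  have h': "h ` Field Q \<subseteq> Field P"
    using h by (simp add: cofinal_map_def)
  have pn: "pointed_net C X P Z x l"
    using x by (simp add: converges_def)
  then have pn': "pointed_net C X Q Z (\<lambda>q. x (h q)) l"
    using h' by (auto simp: pointed_net_def)
  obtain k where k: "k \<in> hom C Z (Dom C (T P))" "T P \<cdot> k = net_arr C X P Z x l"
    using x converges_iff_lift[OF P pn] by blast
  let ?t = "times_map C (reindex C X P Q h) (Id C X)"
  note t = times_reindex_hom[OF X P Q h']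
  have "factors_through C (?t \<cdot> T P) (T Q)"
    using assms(1) P Q h by (simp add: subnets_def)
  from factors_through_comp[OF this T_hom[OF Q] comp_hom[OF T_hom[OF P] t] k(1)]
  have "factors_through C (?t \<cdot> net_arr C X P Z x l) (T Q)"
    using comp_assoc[OF k(1) T_hom[OF P] t] k(2) by simp
  then show ?thesis
    using pn' times_reindex_net_arr[OF X P Q h' pn] by (simp add: converges_def)
qed

context
  fixes P :: "'u rel" and R :: "'u set \<Rightarrow> 'u rel" and h :: "'u set \<Rightarrow> 'u \<Rightarrow> 'u"
  assumes P: "P \<in> dirsets"
    and Rh: "\<And>Q. Q \<in> cofinal_subsets P \<Longrightarrow> R Q \<in> dirsets \<and> cofinal_map (R Q) (Restr P Q) (h Q)"
begin

text \<open>
  The two arrows whose fiber product occurs in the locality axiom: the product of the \<open>\<iota>\<close> over all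
  cofinal subsets, and the arrow that restricts a net along all the chosen maps at once.
\<close>

abbreviation (input) "local_nets \<equiv>
  product_map C (cofinal_subsets P)
    (\<lambda>Q. Dom C (T (R Q))) (\<lambda>Q. netlim C X (R Q)) (\<lambda>Q. T (R Q))"

abbreviation (input) "all_reindex \<equiv>
  tuple C (cofinal_subsets P) (\<lambda>Q. netlim C X (R Q)) (netlim C X P)
    (\<lambda>Q. times_map C (reindex C X P (R Q) (h Q)) (Id C X))"

lemma local_facts:
  assumes "Q \<in> cofinal_subsets P"
  shows "T (R Q) \<in> hom C (Dom C (T (R Q))) (netlim C X (R Q))"
    "times_map C (reindex C X P (R Q) (h Q)) (Id C X) \<in> hom C (netlim C X P) (netlim C X (R Q))"
    "h Q ` Field (R Q) \<subseteq> Field P" "R Q \<in> dirsets"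
    "Dom C (T (R Q)) \<in> Obj C" "netlim C X (R Q) \<in> Obj C"
proof -
  show R: "R Q \<in> dirsets" and h: "h Q ` Field (R Q) \<subseteq> Field P"
    using Rh[OF assms] cofinal_map_Restr by blast+
  show T: "T (R Q) \<in> hom C (Dom C (T (R Q))) (netlim C X (R Q))"
    by (rule T_hom[OF R])
  show "times_map C (reindex C X P (R Q) (h Q)) (Id C X) \<in> hom C (netlim C X P) (netlim C X (R Q))"
    by (rule times_reindex_hom[OF X P R h])
  show "Dom C (T (R Q)) \<in> Obj C" "netlim C X (R Q) \<in> Obj C"
    using homD(4,5)[OF T] .
qed

lemma local_hom:
  "local_nets \<in> hom C (product_obj C (cofinal_subsets P) (\<lambda>Q. Dom C (T (R Q))))
    (product_obj C (cofinal_subsets P) (\<lambda>Q. netlim C X (R Q)))"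
  "all_reindex \<in> hom C (netlim C X P)
    (product_obj C (cofinal_subsets P) (\<lambda>Q. netlim C X (R Q)))"
proof -
  note small = small_cofinal_subsets[OF P]
  show "local_nets \<in> hom C (product_obj C (cofinal_subsets P) (\<lambda>Q. Dom C (T (R Q))))
    (product_obj C (cofinal_subsets P) (\<lambda>Q. netlim C X (R Q)))"
    by (rule product_map_hom[OF small]) (rule local_facts; assumption)+
  show "all_reindex \<in> hom C (netlim C X P)
    (product_obj C (cofinal_subsets P) (\<lambda>Q. netlim C X (R Q)))"
    by (rule tuple_hom[OF small _ netlim_obj[OF X P]]) (rule local_facts; assumption)+
qed

lemma all_reindex_net_arr:
  assumes "pointed_net C X P Z x l"
  shows "all_reindex \<cdot> net_arr C X P Z x l =
    tuple C (cofinal_subsets P) (\<lambda>Q. netlim C X (R Q)) Z (\<lambda>Q. net_arr C X (R Q) Z (\<lambda>r. x (h Q r)) l)"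
proof -
  have "all_reindex \<cdot> net_arr C X P Z x l = tuple C (cofinal_subsets P) (\<lambda>Q. netlim C X (R Q)) Z
      (\<lambda>Q. times_map C (reindex C X P (R Q) (h Q)) (Id C X) \<cdot> net_arr C X P Z x l)"
    by (rule tuple_comp[OF small_cofinal_subsets[OF P] _ net_arr_hom[OF X P assms]])
      (rule local_facts; assumption)+
  also have "\<dots> = tuple C (cofinal_subsets P) (\<lambda>Q. netlim C X (R Q)) Z
      (\<lambda>Q. net_arr C X (R Q) Z (\<lambda>r. x (h Q r)) l)"
    by (rule tuple_cong) (rule times_reindex_net_arr[OF X P local_facts(4,3) assms])
  finally show ?thesis .
qed

text \<open>
  The lifts of the given subnets through the \<open>\<iota>\<close> form one arrow into the product of their domains. It
  agrees with the net itself after restriction, hence both factor through the fiber product, over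
  which the axiom applies.
\<close>

lemma localityD:
  assumes loc: "locality C X T" and x: "pointed_net C X P Z x l"
    and conv: "\<And>Q. Q \<in> cofinal_subsets P \<Longrightarrow> converges C X T (R Q) Z (\<lambda>r. x (h Q r)) l"
  shows "converges C X T P Z x l"
proof -
  note small = small_cofinal_subsets[OF P]
  have "\<exists>k. k \<in> hom C Z (Dom C (T (R Q))) \<and> T (R Q) \<cdot> k = net_arr C X (R Q) Z (\<lambda>r. x (h Q r)) l"
    if "Q \<in> cofinal_subsets P" for Q
    using conv[OF that] converges_iff_lift[OF local_facts(4)[OF that]]
    by (auto simp: converges_def[of C X T "R Q"])
  then obtain k where k: "\<And>Q. Q \<in> cofinal_subsets P \<Longrightarrow> k Q \<in> hom C Z (Dom C (T (R Q)))"
    "\<And>Q. Q \<in> cofinal_subsets P \<Longrightarrow> T (R Q) \<cdot> k Q = net_arr C X (R Q) Z (\<lambda>r. x (h Q r)) l"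
    by metis
  have Z: "Z \<in> Obj C"
    using homD(4)[OF net_arr_hom[OF X P x]] .
  let ?s = "tuple C (cofinal_subsets P) (\<lambda>Q. Dom C (T (R Q))) Z k"
  have s: "?s \<in> hom C Z (product_obj C (cofinal_subsets P) (\<lambda>Q. Dom C (T (R Q))))"
    by (rule tuple_hom[OF small _ Z]) (rule local_facts k; assumption)+
  have "local_nets \<cdot> ?s = tuple C (cofinal_subsets P) (\<lambda>Q. netlim C X (R Q)) Z (\<lambda>Q. T (R Q) \<cdot> k Q)"
    by (rule product_map_tuple[OF small _ Z]) (rule local_facts k; assumption)+
  also have "\<dots> = all_reindex \<cdot> net_arr C X P Z x l"
    unfolding all_reindex_net_arr[OF x] by (rule tuple_cong) (rule k)
  finally have eq: "local_nets \<cdot> ?s = all_reindex \<cdot> net_arr C X P Z x l" .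
  obtain F s' t where F: "is_pullback C local_nets all_reindex F s' t"
    using ex_pullback[OF local_hom] .
  have t: "t \<in> hom C F (netlim C X P)"
    by (rule pullback_hom(2)[OF F local_hom])
  have "factors_through C t (T P)"
    using loc P Rh F unfolding locality_def by blast
  moreover obtain u where u: "u \<in> hom C Z F" "t \<cdot> u = net_arr C X P Z x l"
    using pullback_lift[OF F local_hom s net_arr_hom[OF X P x] eq] by blast
  ultimately show ?thesis
    using factors_through_comp[OF _ T_hom[OF P] t u(1)] x u(2) by (simp add: converges_def)
qed

text \<open>
  The projection from the fiber product is itself a net, and its restrictions converge because the
  other projection supplies the lifts.
\<close>

lemma locality_pullback:
  assumes F: "is_pullback C local_nets all_reindex F s t"
  shows "\<exists>x l. t = net_arr C X P F x l \<and> pointed_net C X P F x l \<and>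
    (\<forall>Q\<in>cofinal_subsets P. converges C X T (R Q) F (\<lambda>r. x (h Q r)) l)"
proof -
  note small = small_cofinal_subsets[OF P]
  have s: "s \<in> hom C F (product_obj C (cofinal_subsets P) (\<lambda>Q. Dom C (T (R Q))))"
    and t: "t \<in> hom C F (netlim C X P)"
    and eq: "local_nets \<cdot> s = all_reindex \<cdot> t"
    using pullback_hom[OF F local_hom] pullback_eq[OF F local_hom] .
  obtain x l where x: "pointed_net C X P F x l" and t_eq: "t = net_arr C X P F x l"
    using net_arr_cases[OF X P t] by blast
  have "converges C X T (R Q) F (\<lambda>r. x (h Q r)) l" if Q: "Q \<in> cofinal_subsets P" for Q
  proof -
    note Q' = local_facts[OF Q]
    have pn: "pointed_net C X (R Q') F (\<lambda>r. x (h Q' r)) l" if "Q' \<in> cofinal_subsets P" for Q'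
      using x local_facts(3)[OF that] by (auto simp: pointed_net_def)
    let ?p = "pr C (cofinal_subsets P) (\<lambda>Q. netlim C X (R Q)) Q"
    let ?q = "pr C (cofinal_subsets P) (\<lambda>Q. Dom C (T (R Q))) Q"
    have p: "?p \<in> hom C (product_obj C (cofinal_subsets P) (\<lambda>Q. netlim C X (R Q))) (netlim C X (R Q))"
      by (rule pr_hom[of "cofinal_subsets P" "\<lambda>Q. netlim C X (R Q)", OF small _ Q])
        (rule local_facts; assumption)
    have q: "?q \<in> hom C (product_obj C (cofinal_subsets P) (\<lambda>Q. Dom C (T (R Q)))) (Dom C (T (R Q)))"
      by (rule pr_hom[of "cofinal_subsets P" "\<lambda>Q. Dom C (T (R Q))", OF small _ Q])
        (rule local_facts; assumption)
    have "net_arr C X (R Q) F (\<lambda>r. x (h Q r)) l = ?p \<cdot> (all_reindex \<cdot> t)"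
      unfolding t_eq all_reindex_net_arr[OF x]
      by (rule pr_tuple[symmetric, OF small _ homD(4)[OF s] _ Q])
        (rule local_facts net_arr_hom[OF X local_facts(4) pn]; assumption)+
    also have "\<dots> = (?p \<cdot> local_nets) \<cdot> s"
      unfolding eq[symmetric] by (rule comp_assoc[OF s local_hom(1) p, symmetric])
    also have "?p \<cdot> local_nets = T (R Q) \<cdot> ?q"
      by (rule pr_product_map[OF small _ _ _ Q]) (rule local_facts; assumption)+
    also have "(T (R Q) \<cdot> ?q) \<cdot> s = T (R Q) \<cdot> (?q \<cdot> s)"
      by (rule comp_assoc[OF s q Q'(1)])
    finally show ?thesis
      using converges_iff_lift[OF Q'(4) pn[OF Q]] comp_hom[OF s q] by auto
  qed
  then show ?thesis
    using x t_eq by blast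
qed

end

lemma localityI:
  assumes "\<And>P R h Z x l. P \<in> dirsets \<Longrightarrow>
    (\<And>Q. Q \<in> cofinal_subsets P \<Longrightarrow> R Q \<in> dirsets \<and> cofinal_map (R Q) (Restr P Q) (h Q)) \<Longrightarrow>
    pointed_net C X P Z x l \<Longrightarrow>
    (\<And>Q. Q \<in> cofinal_subsets P \<Longrightarrow> converges C X T (R Q) Z (\<lambda>r. x (h Q r)) l) \<Longrightarrow>
    converges C X T P Z x l"
  shows "locality C X T"
  unfolding locality_def
proof (intro ballI allI impI)
  fix P :: "'u rel" and R h F s t
  assume P: "P \<in> dirsets"
    and Rh: "\<forall>Q\<in>cofinal_subsets P. R Q \<in> dirsets \<and> cofinal_map (R Q) (Restr P Q) (h Q)"
    and F: "is_pullback C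
      (product_map C (cofinal_subsets P)
        (\<lambda>Q. Dom C (T (R Q))) (\<lambda>Q. netlim C X (R Q)) (\<lambda>Q. T (R Q)))
      (tuple C (cofinal_subsets P) (\<lambda>Q. netlim C X (R Q)) (netlim C X P)
        (\<lambda>Q. times_map C (reindex C X P (R Q) (h Q)) (Id C X))) F s t"
  obtain x l where x: "t = net_arr C X P F x l" "pointed_net C X P F x l"
    "\<forall>Q\<in>cofinal_subsets P. converges C X T (R Q) F (\<lambda>r. x (h Q r)) l"
    using locality_pullback[OF P bspec[OF Rh] F] by blast
  have "converges C X T P F x l"
    using assms[OF P bspec[OF Rh] x(2) bspec[OF x(3)]] .
  then show "factors_through C t (T P)"
    using x(1) by (simp add: converges_def)
qed

context
  fixes P :: "'u rel" and Q :: "'u \<Rightarrow> 'u rel"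
  assumes P: "P \<in> dirsets" and Q: "\<And>p. p \<in> Field P \<Longrightarrow> Q p \<in> dirsets"
begin

abbreviation (input) "iterated_limits \<equiv>
  product_map C (Field P) (\<lambda>p. Dom C (T (Q p))) (\<lambda>_. X) (\<lambda>p. lim_of C X T (Q p))"

lemma iteration_facts:
  assumes "p \<in> Field P"
  shows "Dom C (T (Q p)) \<in> Obj C"
    "net_of C X T (Q p) \<in> hom C (Dom C (T (Q p))) (power_obj C X (Q p))"
    "lim_of C X T (Q p) \<in> hom C (Dom C (T (Q p))) X"
  using homD(4)[OF T_hom[OF Q[OF assms]]] net_of_hom[OF Q[OF assms]] .

lemma iterated_limits_hom:
  "iterated_limits \<in> hom C (product_obj C (Field P) (\<lambda>p. Dom C (T (Q p)))) (power_obj C X P)"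
  unfolding power_obj_def
  by (rule product_map_hom[of _ _ "\<lambda>_. X", OF small_Field[OF P]]) (rule iteration_facts X; assumption?)+

lemma pr_Dom_hom:
  "p \<in> Field P \<Longrightarrow> pr C (Field P) (\<lambda>p. Dom C (T (Q p))) p
    \<in> hom C (product_obj C (Field P) (\<lambda>p. Dom C (T (Q p)))) (Dom C (T (Q p)))"
  by (rule pr_hom[of _ "\<lambda>p. Dom C (T (Q p))", OF small_Field[OF P]]) (rule iteration_facts; assumption)+

text \<open>
  Here a generalized element of the fiber product is a convergent net \<open>y\<close> along with, for each \<open>p\<close>, a
  net that converges to \<open>y p\<close>. The axiom for the fiber product is therefore the generic instance, and
  the given nets are obtained from it by composition with the induced arrow \<open>u\<close>.
\<close>

lemma iterationsD:
  assumes it: "iterations C X T" and R: "R \<in> dirsets" and e: "order_iso R (iteration_order P Q) e"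
    and x: "\<And>p. p \<in> Field P \<Longrightarrow> converges C X T (Q p) Z (x p) (y p)"
    and y: "converges C X T P Z y l"
  shows "converges C X T R Z (\<lambda>r. case e r of (p, f) \<Rightarrow> x p (f p)) l"
proof -
  note small = small_Field[OF P]
  have "\<forall>p\<in>Field P. Q p \<in> dirsets"
    using Q by blast
  note er = order_iso_iteration_order[OF P this e]
  have yn: "pointed_net C X P Z y l"
    using y by (simp add: converges_def)
  have xn: "pointed_net C X (Q p) Z (x p) (y p)" if "p \<in> Field P" for p
    using x[OF that] by (simp add: converges_def)
  have Z: "Z \<in> Obj C"
    using homD(4)[OF net_arr_hom[OF X P yn]] .
  have "\<exists>k. k \<in> hom C Z (Dom C (T (Q p))) \<and> T (Q p) \<cdot> k = net_arr C X (Q p) Z (x p) (y p)"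
    if "p \<in> Field P" for p
    using x[OF that] converges_iff_lift[OF Q[OF that] xn[OF that]] by blast
  then obtain k where k: "\<And>p. p \<in> Field P \<Longrightarrow> k p \<in> hom C Z (Dom C (T (Q p)))"
    "\<And>p. p \<in> Field P \<Longrightarrow> T (Q p) \<cdot> k p = net_arr C X (Q p) Z (x p) (y p)"
    by metis
  obtain j where j: "j \<in> hom C Z (Dom C (T P))" "T P \<cdot> j = net_arr C X P Z y l"
    using y converges_iff_lift[OF P yn] by blast
  let ?k = "tuple C (Field P) (\<lambda>p. Dom C (T (Q p))) Z k"
  have tk: "?k \<in> hom C Z (product_obj C (Field P) (\<lambda>p. Dom C (T (Q p))))"
    by (rule tuple_hom[OF small _ Z]) (rule iteration_facts k; assumption)+
  have "iterated_limits \<cdot> ?k = tuple C (Field P) (\<lambda>_. X) Z (\<lambda>p. lim_of C X T (Q p) \<cdot> k p)"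
    by (rule product_map_tuple[OF small _ Z]) (rule iteration_facts k; assumption)+
  also have "\<dots> = tuple C (Field P) (\<lambda>_. X) Z y"
    by (rule tuple_cong) (rule net_of_lift(2)[OF Q xn k(1) k(2)]; assumption)
  also have "\<dots> = net_of C X T P \<cdot> j"
    by (rule net_of_lift(1)[OF P yn j, symmetric])
  finally have eq: "iterated_limits \<cdot> ?k = net_of C X T P \<cdot> j" .
  obtain G s t where G: "is_pullback C iterated_limits (net_of C X T P) G s t"
    using ex_pullback[OF iterated_limits_hom net_of_hom(1)[OF P]] .
  have s: "s \<in> hom C G (product_obj C (Field P) (\<lambda>p. Dom C (T (Q p))))"
    and t: "t \<in> hom C G (Dom C (T P))"
    using pullback_hom[OF G iterated_limits_hom net_of_hom(1)[OF P]] .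
  obtain u where u: "u \<in> hom C Z G" "s \<cdot> u = ?k" "t \<cdot> u = j"
    using pullback_lift[OF G iterated_limits_hom net_of_hom(1)[OF P] tk j(1) eq] by blast
  \<comment> \<open>The generic family of inner nets, literally as it occurs in the axiom.\<close>
  define w where "w = (\<lambda>p q. proj_at C X (Q p) q \<cdot> net_of C X T (Q p) \<cdot>
    pr C (Field P) (\<lambda>p. Dom C (T (Q p))) p \<cdot> s)"
  have w: "w p q \<in> hom C G X" "w p q \<cdot> u = x p q" if p: "p \<in> Field P" and q: "q \<in> Field (Q p)" for p q
  proof -
    note hs = s pr_Dom_hom[OF p] iteration_facts(2)[OF p] proj_at_hom[OF X Q[OF p] q]
    show "w p q \<in> hom C G X"
      unfolding w_def by (rule comp_hom[OF _ hs(4)] comp_hom[OF _ hs(3)] comp_hom[OF hs(1,2)])+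
    have "w p q \<cdot> u = proj_at C X (Q p) q \<cdot> net_of C X T (Q p) \<cdot>
        pr C (Field P) (\<lambda>p. Dom C (T (Q p))) p \<cdot> (s \<cdot> u)"
      using hs u(1) by (simp add: w_def hom_def)
    also have "pr C (Field P) (\<lambda>p. Dom C (T (Q p))) p \<cdot> (s \<cdot> u) = k p"
      unfolding u(2) by (rule pr_tuple[OF small _ Z _ p]) (rule iteration_facts k; assumption)+
    also have "net_of C X T (Q p) \<cdot> k p = tuple C (Field (Q p)) (\<lambda>_. X) Z (x p)"
      by (rule net_of_lift(1)[OF Q[OF p] xn[OF p] k(1)[OF p] k(2)[OF p]])
    also have "proj_at C X (Q p) q \<cdot> \<dots> = x p q"
      by (rule power_tuple(2)[OF X Q[OF p] xn[OF p] q])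
    finally show "w p q \<cdot> u = x p q" .
  qed
  let ?w = "\<lambda>r. case e r of (p, f) \<Rightarrow> w p (f p)"
  have "factors_through C (net_arr C X R G ?w (lim_of C X T P \<cdot> t)) (T R)"
    unfolding net_arr_def w_def
    using it[unfolded iterations_def Let_def, rule_format, OF P Q R e G] .
  moreover have "pointed_net C X R G ?w (lim_of C X T P \<cdot> t)"
    using comp_hom[OF t net_of_hom(2)[OF P]] w(1) er
    by (simp add: pointed_net_def case_prod_unfold)
  ultimately have "converges C X T R G ?w (lim_of C X T P \<cdot> t)"
    by (simp add: converges_def)
  note conv = converges_comp[OF R this u(1)]
  have lim: "(lim_of C X T P \<cdot> t) \<cdot> u = l"
    using comp_assoc[OF u(1) t net_of_hom(2)[OF P]] u(3) net_of_lift(2)[OF P yn j] by simp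
  have nets: "?w r \<cdot> u = (case e r of (p, f) \<Rightarrow> x p (f p))" if "r \<in> Field R" for r
    using w(2) er[OF that] by (simp add: case_prod_unfold)
  from converges_cong[THEN iffD1, OF nets conv[unfolded lim]] show ?thesis .
qed

text \<open>
  The fiber product carries the generic iterated net. Its outer net has two descriptions, by the
  limits of the inner nets and by the second projection, and they agree because the fiber product is
  taken over \<open>X\<^sup>P\<close>.
\<close>

lemma iterations_pullback:
  assumes G: "is_pullback C iterated_limits (net_of C X T P) G s t"
  defines "x \<equiv> \<lambda>p q. proj_at C X (Q p) q \<cdot> net_of C X T (Q p) \<cdot>
      pr C (Field P) (\<lambda>p. Dom C (T (Q p))) p \<cdot> s"
    and "y \<equiv> \<lambda>p. lim_of C X T (Q p) \<cdot> pr C (Field P) (\<lambda>p. Dom C (T (Q p))) p \<cdot> s"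
  shows "p \<in> Field P \<Longrightarrow> converges C X T (Q p) G (x p) (y p)"
    and "converges C X T P G y (lim_of C X T P \<cdot> t)"
proof -
  note small = small_Field[OF P]
  have s: "s \<in> hom C G (product_obj C (Field P) (\<lambda>p. Dom C (T (Q p))))"
    and t: "t \<in> hom C G (Dom C (T P))" and eq: "iterated_limits \<cdot> s = net_of C X T P \<cdot> t"
    using pullback_hom[OF G iterated_limits_hom net_of_hom(1)[OF P]]
      pullback_eq[OF G iterated_limits_hom net_of_hom(1)[OF P]] .
  show "converges C X T (Q p) G (x p) (y p)" if p: "p \<in> Field P"
  proof -
    note ps = comp_hom[OF s pr_Dom_hom[OF p]]
    have "(proj_at C X (Q p) q \<cdot> net_of C X T (Q p)) \<cdot>
        (pr C (Field P) (\<lambda>p. Dom C (T (Q p))) p \<cdot> s) = x p q" if "q \<in> Field (Q p)" for q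
      unfolding x_def by (rule comp_assoc[OF ps iteration_facts(2)[OF p] proj_at_hom[OF X Q[OF p] that]])
    from converges_cong[THEN iffD1, OF this converges_comp[OF Q[OF p] universal_net(2)[OF Q[OF p]] ps]]
    show ?thesis
      unfolding y_def .
  qed
  have "(proj_at C X P p \<cdot> net_of C X T P) \<cdot> t = y p" if p: "p \<in> Field P" for p
  proof -
    note proj = proj_at_hom[OF X P p]
    have "(proj_at C X P p \<cdot> net_of C X T P) \<cdot> t = (proj_at C X P p \<cdot> iterated_limits) \<cdot> s"
      using comp_assoc[OF t net_of_hom(1)[OF P] proj] comp_assoc[OF s iterated_limits_hom proj] eq
      by simp
    also have "proj_at C X P p \<cdot> iterated_limits =
        lim_of C X T (Q p) \<cdot> pr C (Field P) (\<lambda>p. Dom C (T (Q p))) p"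
      unfolding proj_at_def
      by (rule pr_product_map[OF small _ X _ p]) (rule iteration_facts; assumption)+
    also have "\<dots> \<cdot> s = y p"
      unfolding y_def by (rule comp_assoc[OF s pr_Dom_hom[OF p] iteration_facts(3)[OF p]])
    finally show ?thesis .
  qed
  from converges_cong[THEN iffD1, OF this converges_comp[OF P universal_net(2)[OF P] t]]
  show "converges C X T P G y (lim_of C X T P \<cdot> t)" .
qed

end

lemma iterationsI:
  assumes "\<And>P Q R e Z x y l. P \<in> dirsets \<Longrightarrow> (\<And>p. p \<in> Field P \<Longrightarrow> Q p \<in> dirsets) \<Longrightarrow>
    R \<in> dirsets \<Longrightarrow> order_iso R (iteration_order P Q) e \<Longrightarrow>
    (\<And>p. p \<in> Field P \<Longrightarrow> converges C X T (Q p) Z (x p) (y p)) \<Longrightarrow>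
    converges C X T P Z y l \<Longrightarrow>
    converges C X T R Z (\<lambda>r. case e r of (p, f) \<Rightarrow> x p (f p)) l"
  shows "iterations C X T"
  unfolding iterations_def
proof (intro ballI allI impI)
  fix P R :: "'u rel" and Q e G s t
  assume P: "P \<in> dirsets" and Q: "\<forall>p\<in>Field P. Q p \<in> dirsets" and R: "R \<in> dirsets"
    and e: "order_iso R (iteration_order P Q) e"
    and G: "is_pullback C (product_map C (Field P) (\<lambda>p. Dom C (T (Q p))) (\<lambda>_. X)
      (\<lambda>p. lim_of C X T (Q p))) (net_of C X T P) G s t"
  note Q = bspec[OF Q]
  note conv = iterations_pullback[of P Q, OF P Q G]
  show "factors_through C
      (pair C (power_obj C X R) X G
        (tuple C (Field R) (\<lambda>_. X) G
          (\<lambda>r. let (p, f) = e r in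
             proj_at C X (Q p) (f p) \<cdot> net_of C X T (Q p) \<cdot>
               pr C (Field P) (\<lambda>p. Dom C (T (Q p))) p \<cdot> s))
        (lim_of C X T P \<cdot> t))
      (T R)"
    using assms[OF P Q R e conv] by (simp add: converges_def net_arr_def)
qed

end

section \<open>Intersections of large families of subobjects\<close>

context small_complete_category
begin

lemma small_intersection:
  assumes I: "small TYPE('u) I" and Y: "Y \<in> Obj C"
    and m: "\<And>i. i \<in> I \<Longrightarrow> mono_arr C (m i)" "\<And>i. i \<in> I \<Longrightarrow> m i \<in> hom C (A i) Y"
  obtains n L where "mono_arr C n" "n \<in> hom C L Y"
    "\<forall>Z. \<forall>z\<in>hom C Z Y. factors_through C z n \<longleftrightarrow> (\<forall>i\<in>I. factors_through C z (m i))"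
proof -
  obtain n L p where n: "n \<in> hom C L Y"
    and p: "\<forall>i\<in>I. p i \<in> hom C L (A i)" and eq: "\<forall>i\<in>I. m i \<cdot> p i = n"
    and lift: "\<forall>Z. \<forall>s\<in>hom C Z Y. \<forall>r. (\<forall>i\<in>I. r i \<in> hom C Z (A i)) \<and> (\<forall>i\<in>I. m i \<cdot> r i = s) \<longrightarrow>
       (\<exists>!h. h \<in> hom C Z L \<and> n \<cdot> h = s \<and> (\<forall>i\<in>I. p i \<cdot> h = r i))"
    using ex_wide_pullback[of I Y m A, OF I Y m(2)] .
  note p = bspec[OF p] and eq = bspec[OF eq] and lift = lift[rule_format, OF _ conjI[OF ballI ballI]]
  have tri: "m i \<cdot> (p i \<cdot> h) = n \<cdot> h" if "i \<in> I" "h \<in> hom C Z L" for i h Z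
    using comp_assoc[OF that(2) p[OF that(1)] m(2)[OF that(1)]] eq[OF that(1)] by simp
  have "mono_arr C n"
  proof (rule mono_arrI[OF n])
    fix Z a b
    assume a: "a \<in> hom C Z L" and b: "b \<in> hom C Z L" and ab: "n \<cdot> a = n \<cdot> b"
    have "p i \<cdot> a = p i \<cdot> b" if i: "i \<in> I" for i
      by (rule mono_arrD[OF m(1)[OF i] m(2)[OF i] comp_hom[OF a p[OF i]] comp_hom[OF b p[OF i]]])
        (simp add: tri[OF i a] tri[OF i b] ab)
    moreover have "\<exists>!h. h \<in> hom C Z L \<and> n \<cdot> h = n \<cdot> b \<and> (\<forall>i\<in>I. p i \<cdot> h = p i \<cdot> b)"
      by (rule lift[OF comp_hom[OF b n] comp_hom[OF b p] tri[OF _ b]])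
    ultimately show "a = b"
      using a b ab by blast
  qed
  moreover have "factors_through C z n \<longleftrightarrow> (\<forall>i\<in>I. factors_through C z (m i))"
    if z: "z \<in> hom C Z Y" for Z z
  proof
    assume "factors_through C z n"
    then obtain h where h: "h \<in> hom C Z L" "n \<cdot> h = z"
      using factors_through_hom_iff[OF z] homD(2)[OF n] by auto
    show "\<forall>i\<in>I. factors_through C z (m i)"
    proof
      fix i assume i: "i \<in> I"
      show "factors_through C z (m i)"
        using factors_through_hom_iff[OF z] homD(2)[OF m(2)[OF i]] comp_hom[OF h(1) p[OF i]]
          tri[OF i h(1)] h(2) by auto
    qed
  next
    assume "\<forall>i\<in>I. factors_through C z (m i)"
    then have "\<forall>i\<in>I. \<exists>r. r \<in> hom C Z (A i) \<and> m i \<cdot> r = z"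
      using factors_through_hom_iff[OF z] homD(2)[OF m(2)] by fastforce
    then obtain r where r: "\<And>i. i \<in> I \<Longrightarrow> r i \<in> hom C Z (A i)" "\<And>i. i \<in> I \<Longrightarrow> m i \<cdot> r i = z"
      by metis
    from ex1_implies_ex[OF lift[OF z r]] show "factors_through C z n"
      using factors_through_hom_iff[OF z] homD(2)[OF n] by auto
  qed
  ultimately show thesis
    using n by (intro that) auto
qed

text \<open>
  Isomorphic monomorphisms impose the same condition on \<open>z\<close>, so one representative of each class of
  subobjects that occurs in the family is enough, and by wellpoweredness these classes form a small
  set.
\<close>

lemma large_intersection:
  fixes I :: "'i set"
  assumes wp: "wellpowered TYPE('u) C" and Y: "Y \<in> Obj C"
    and m: "\<And>i. i \<in> I \<Longrightarrow> mono_arr C (m i)" "\<And>i. i \<in> I \<Longrightarrow> m i \<in> hom C (A i) Y"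
  obtains n L where "mono_arr C n" "n \<in> hom C L Y"
    "\<forall>Z. \<forall>z\<in>hom C Z Y. factors_through C z n \<longleftrightarrow> (\<forall>i\<in>I. factors_through C z (m i))"
proof -
  define cls where "cls i = subobject_rel C Y `` {m i}" for i
  define rep where "rep c = (SOME i. i \<in> I \<and> cls i = c)" for c
  have rep: "rep (cls i) \<in> I \<and> cls (rep (cls i)) = cls i" if "i \<in> I" for i
    unfolding rep_def by (rule someI[of _ i]) (simp add: that)
  have mem: "m i \<in> monos_into C Y" if "i \<in> I" for i
    using m(1)[OF that] homD(3)[OF m(2)[OF that]] by (simp add: monos_into_def)
  have "cls ` I \<subseteq> monos_into C Y // subobject_rel C Y"
    using mem by (auto simp: cls_def quotient_def)
  moreover have "small TYPE('u) (monos_into C Y // subobject_rel C Y)"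
    using wp Y by (simp add: wellpowered_def)
  ultimately have J: "small TYPE('u) (cls ` I)"
    by - (rule small_inj[of _ "monos_into C Y // subobject_rel C Y" id], auto)
  have same: "factors_through C z (m (rep (cls i))) \<longleftrightarrow> factors_through C z (m i)"
    if i: "i \<in> I" and z: "z \<in> hom C Z Y" for i z Z
  proof -
    have j: "rep (cls i) \<in> I" "cls (rep (cls i)) = cls i"
      using rep[OF i] by simp_all
    have "factors_through C (m i) (m i)"
      using m(2)[OF i] id_hom[OF homD(4)[OF m(2)[OF i]]] comp_id_right[OF m(2)[OF i]]
      by (auto simp: factors_through_def hom_def)
    then have "m i \<in> cls i"
      using mem[OF i] by (simp add: cls_def subobject_rel_def)
    then have "m i \<in> cls (rep (cls i))"
      by (simp add: j(2))
    then have "(m (rep (cls i)), m i) \<in> subobject_rel C Y"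
      by (simp only: cls_def[of "rep (cls i)"] Image_singleton_iff)
    then have "factors_through C (m i) (m (rep (cls i)))" "factors_through C (m (rep (cls i))) (m i)"
      by (simp_all add: subobject_rel_def)
    then show ?thesis
      using factors_through_trans[OF z m(2)[OF i] m(2)[OF j(1)]]
        factors_through_trans[OF z m(2)[OF j(1)] m(2)[OF i]] by blast
  qed
  have mJ: "mono_arr C (m (rep c))" "m (rep c) \<in> hom C (A (rep c)) Y" if "c \<in> cls ` I" for c
    using that rep m by auto
  obtain n L where n: "mono_arr C n" "n \<in> hom C L Y"
    and fac: "\<forall>Z. \<forall>z\<in>hom C Z Y.
      factors_through C z n \<longleftrightarrow> (\<forall>c\<in>cls ` I. factors_through C z (m (rep c)))"
    using small_intersection[of "cls ` I" Y "\<lambda>c. m (rep c)" "\<lambda>c. A (rep c)", OF J Y mJ] .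
  have "factors_through C z n \<longleftrightarrow> (\<forall>i\<in>I. factors_through C z (m i))" if "z \<in> hom C Z Y" for Z z
    using fac[rule_format, OF that] same[OF _ that] by simp
  with n show thesis
    by (intro that) auto
qed

text \<open>
  The condition on \<open>z\<close> for a single \<open>i\<close> says that \<open>z\<close> factors through the pullback of \<open>n i\<close> along
  \<open>g i\<close>, so the intersection of these pullbacks is the subobject wanted.
\<close>

lemma ex_initial_subobject:
  fixes I :: "'i set"
  assumes wp: "wellpowered TYPE('u) C" and Y: "Y \<in> Obj C"
    and g: "\<And>i. i \<in> I \<Longrightarrow> g i \<in> hom C Y (W i)"
    and n: "\<And>i. i \<in> I \<Longrightarrow> mono_arr C (n i)" "\<And>i. i \<in> I \<Longrightarrow> n i \<in> hom C (B i) (W i)"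
  obtains m where "mono_arr C m" "Cod C m = Y"
    "\<forall>Z. \<forall>z\<in>hom C Z Y. factors_through C z m \<longleftrightarrow> (\<forall>i\<in>I. factors_through C (g i \<cdot> z) (n i))"
proof -
  have "\<exists>L p q. is_pullback C (n i) (g i) L p q" if "i \<in> I" for i
    using ex_pullback[OF n(2)[OF that] g[OF that]] by blast
  then obtain L p q where L: "\<And>i. i \<in> I \<Longrightarrow> is_pullback C (n i) (g i) (L i) (p i) (q i)"
    by metis
  have q: "mono_arr C (q i)" "q i \<in> hom C (L i) Y" if "i \<in> I" for i
    using pullback_mono(1)[OF L[OF that] n(2)[OF that] g[OF that] n(1)[OF that]]
      pullback_hom(2)[OF L[OF that] n(2)[OF that] g[OF that]] .
  obtain m M where m: "mono_arr C m" "m \<in> hom C M Y"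
    and fac: "\<forall>Z. \<forall>z\<in>hom C Z Y. factors_through C z m \<longleftrightarrow> (\<forall>i\<in>I. factors_through C z (q i))"
    using large_intersection[of Y I q L, OF wp Y q] .
  have "factors_through C z m \<longleftrightarrow> (\<forall>i\<in>I. factors_through C (g i \<cdot> z) (n i))"
    if z: "z \<in> hom C Z Y" for Z z
    using fac[rule_format, OF z] pullback_mono(2)[OF L n(2) g n(1) z] by blast
  with m(1) homD(3)[OF m(2)] show thesis
    by (intro that) auto
qed


section \<open>Continuity and initial topologies\<close>

lemma top_object_structure:
  fixes A :: "'o \<times> ('u rel \<Rightarrow> 'a)"
  assumes "A \<in> top_objects C"
  shows "convergence_structure C (fst A) (snd A)"
proof (intro convergence_structure.intro convergence_structure_axioms.intro small_complete_category_axioms)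
  show "fst A \<in> Obj C"
    using assms by (auto simp: top_objects_def)
  show "snd A P \<in> hom C (Dom C (snd A P)) (netlim C (fst A) P)" if "P \<in> dirsets" for P
    using assms that by (auto simp: top_objects_def net_topology_def mono_arr_def hom_def)
qed

text \<open>
  Continuity is the assertion about the universal net of \<open>A\<close>, and it passes to all convergent nets by
  composition.
\<close>

lemma continuous_arr_iff:
  fixes A B :: "'o \<times> ('u rel \<Rightarrow> 'a)"
  assumes A: "A \<in> top_objects C" and B: "B \<in> top_objects C" and f: "f \<in> hom C (fst A) (fst B)"
  shows "continuous_arr C A B f \<longleftrightarrow>
    (\<forall>P\<in>dirsets. \<forall>Z x l. converges C (fst A) (snd A) P Z x l \<longrightarrow>
       converges C (fst B) (snd B) P Z (\<lambda>p. f \<cdot> x p) (f \<cdot> l))" (is "_ \<longleftrightarrow> ?R")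
proof -
  interpret A: convergence_structure C "TYPE('u)" "fst A" "snd A"
    by (rule top_object_structure[OF A])
  interpret B: convergence_structure C "TYPE('u)" "fst B" "snd B"
    by (rule top_object_structure[OF B])
  have pn: "pointed_net C (fst B) P Z (\<lambda>p. f \<cdot> x p) (f \<cdot> l)"
    if "pointed_net C (fst A) P Z x l" for P :: "'u rel" and Z x l
    using that comp_hom[OF _ f] by (simp add: pointed_net_def)
  have "factors_through C (times_map C (power_map C P f) f \<cdot> snd A P) (snd B P) \<longleftrightarrow>
      (\<forall>Z x l. converges C (fst A) (snd A) P Z x l \<longrightarrow>
        converges C (fst B) (snd B) P Z (\<lambda>p. f \<cdot> x p) (f \<cdot> l))" (is "?F \<longleftrightarrow> ?G")
    if P: "P \<in> dirsets" for P
  proof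
    note t = times_power_map_hom[OF f P]
    assume F: ?F
    show ?G
    proof (intro allI impI)
      fix Z x l
      assume x: "converges C (fst A) (snd A) P Z x l"
      then have xn: "pointed_net C (fst A) P Z x l"
        by (simp add: converges_def)
      obtain k where k: "k \<in> hom C Z (Dom C (snd A P))" "snd A P \<cdot> k = net_arr C (fst A) P Z x l"
        using x A.converges_iff_lift[OF P xn] by blast
      show "converges C (fst B) (snd B) P Z (\<lambda>p. f \<cdot> x p) (f \<cdot> l)"
        using factors_through_comp[OF F B.T_hom[OF P] comp_hom[OF A.T_hom[OF P] t] k(1)]
          comp_assoc[OF k(1) A.T_hom[OF P] t] k(2) times_power_map_net_arr[OF f P xn] pn[OF xn]
        by (simp add: converges_def)
    qed
  next
    assume ?G
    note u = A.universal_net[OF P]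
    have un: "pointed_net C (fst A) P (Dom C (snd A P))
        (\<lambda>p. proj_at C (fst A) P p \<cdot> net_of C (fst A) (snd A) P) (lim_of C (fst A) (snd A) P)"
      using u(2) by (simp add: converges_def)
    have "times_map C (power_map C P f) f \<cdot> snd A P = net_arr C (fst B) P (Dom C (snd A P))
        (\<lambda>p. f \<cdot> proj_at C (fst A) P p \<cdot> net_of C (fst A) (snd A) P) (f \<cdot> lim_of C (fst A) (snd A) P)"
      using times_power_map_net_arr[OF f P un] unfolding u(1)[symmetric] .
    then show ?F
      using \<open>?G\<close>[rule_format, OF u(2)] by (simp add: converges_def)
  qed
  then show ?thesis
    using f by (simp add: continuous_arr_def)
qed

text \<open>
  The subobjects come from \<open>ex_initial_subobject\<close>, applied to the arrows \<open>f\<^sub>i\<^sup>P \<times> f\<^sub>i\<close>. Once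
  convergence in \<open>X\<close> is known to mean convergence of all images, each axiom is checked by pushing the
  nets forward to every \<open>S i\<close> and using the axiom there.
\<close>

lemma ex_initial_topology:
  fixes I :: "'i set" and S :: "'i \<Rightarrow> 'o \<times> ('u rel \<Rightarrow> 'a)"
  assumes wp: "wellpowered TYPE('u) C" and X: "X \<in> Obj C"
    and S: "\<And>i. i \<in> I \<Longrightarrow> S i \<in> top_objects C" and f: "\<And>i. i \<in> I \<Longrightarrow> f i \<in> hom C X (fst (S i))"
  obtains T :: "'u rel \<Rightarrow> 'a" where "(X, T) \<in> top_objects C"
    "\<forall>P\<in>dirsets. \<forall>Z x l. pointed_net C X P Z x l \<longrightarrow> (converges C X T P Z x l \<longleftrightarrow>
      (\<forall>i\<in>I. converges C (fst (S i)) (snd (S i)) P Z (\<lambda>p. f i \<cdot> x p) (f i \<cdot> l)))"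
proof -
  have S_cs: "convergence_structure C (fst (S i)) (snd (S i))" if "i \<in> I" for i
    by (rule top_object_structure[OF S[OF that]])
  have S_top: "net_topology C (fst (S i)) (snd (S i))" if "i \<in> I" for i
    using S[OF that] by (auto simp: top_objects_def)
  have pn: "pointed_net C (fst (S i)) P Z (\<lambda>p. f i \<cdot> x p) (f i \<cdot> l)"
    if "i \<in> I" "pointed_net C X P Z x l" for i and P :: "'u rel" and Z x l
    using that(2) comp_hom[OF _ f[OF that(1)]] by (simp add: pointed_net_def)
  have "\<exists>m. mono_arr C m \<and> Cod C m = netlim C X P \<and> (\<forall>Z. \<forall>z\<in>hom C Z (netlim C X P).
      factors_through C z m \<longleftrightarrow>
        (\<forall>i\<in>I. factors_through C (times_map C (power_map C P (f i)) (f i) \<cdot> z) (snd (S i) P)))"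
    if P: "P \<in> dirsets" for P :: "'u rel"
  proof -
    have n: "mono_arr C (snd (S i) P)" if "i \<in> I" for i
      using S_top[OF that] P by (simp add: net_topology_def)
    show ?thesis
      by (rule ex_initial_subobject[of "netlim C X P" I _ _ "\<lambda>i. snd (S i) P",
            OF wp netlim_obj[OF X P] times_power_map_hom[OF f P] n
              convergence_structure.T_hom[OF S_cs P]]) blast+
  qed
  then obtain m where m: "\<And>P. P \<in> dirsets \<Longrightarrow> mono_arr C (m P)"
    "\<And>P. P \<in> dirsets \<Longrightarrow> Cod C (m P) = netlim C X P"
    and fac: "\<And>P Z z. P \<in> dirsets \<Longrightarrow> z \<in> hom C Z (netlim C X P) \<Longrightarrow> factors_through C z (m P) \<longleftrightarrow>
        (\<forall>i\<in>I. factors_through C (times_map C (power_map C P (f i)) (f i) \<cdot> z) (snd (S i) P))"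
    by metis
  define T where "T = restrict m dirsets"
  have T: "T \<in> extensional dirsets" "\<And>P. P \<in> dirsets \<Longrightarrow> mono_arr C (T P)"
    "\<And>P. P \<in> dirsets \<Longrightarrow> Cod C (T P) = netlim C X P"
    using m by (simp_all add: T_def)
  have conv: "converges C X T P Z x l \<longleftrightarrow>
      (\<forall>i\<in>I. converges C (fst (S i)) (snd (S i)) P Z (\<lambda>p. f i \<cdot> x p) (f i \<cdot> l))"
    if P: "P \<in> dirsets" and x: "pointed_net C X P Z x l" for P Z x l
    using fac[OF P net_arr_hom[OF X P x]] times_power_map_net_arr[OF f P x] x pn[OF _ x] P
    by (simp add: converges_def T_def)
  interpret convergence_structure C "TYPE('u)" X T
    by unfold_locales (use X T in \<open>auto simp: hom_def mono_arr_def\<close>)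
  have convI: "converges C X T P Z x l" if "P \<in> dirsets" "pointed_net C X P Z x l"
    "\<And>i. i \<in> I \<Longrightarrow> converges C (fst (S i)) (snd (S i)) P Z (\<lambda>p. f i \<cdot> x p) (f i \<cdot> l)" for P Z x l
    using conv[OF that(1,2)] that(3) by blast
  have convD: "pointed_net C X P Z x l"
    "\<And>i. i \<in> I \<Longrightarrow> converges C (fst (S i)) (snd (S i)) P Z (\<lambda>p. f i \<cdot> x p) (f i \<cdot> l)"
    if "P \<in> dirsets" "converges C X T P Z x l" for P Z x l
  proof -
    show x: "pointed_net C X P Z x l"
      using that(2) by (simp add: converges_def)
    show "\<And>i. i \<in> I \<Longrightarrow> converges C (fst (S i)) (snd (S i)) P Z (\<lambda>p. f i \<cdot> x p) (f i \<cdot> l)"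
      using conv[OF that(1) x] that(2) by blast
  qed
  have "constant_nets C X T"
  proof (rule constant_netsI, rule convI)
    fix P :: "'u rel" and Z x i
    assume P: "P \<in> dirsets" and x: "x \<in> hom C Z X"
    then show "pointed_net C X P Z (\<lambda>_. x) x"
      by (simp add: pointed_net_def)
    assume i: "i \<in> I"
    show "converges C (fst (S i)) (snd (S i)) P Z (\<lambda>_. f i \<cdot> x) (f i \<cdot> x)"
      using convergence_structure.constant_netsD[OF S_cs[OF i] _ P comp_hom[OF x f[OF i]]] S_top[OF i]
      by (simp add: net_topology_def)
  qed
  moreover have "subnets C X T"
  proof (rule subnetsI, rule convI)
    fix P Q :: "'u rel" and h Z x l i
    assume P: "P \<in> dirsets" and Q: "Q \<in> dirsets" and h: "cofinal_map Q P h"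
      and x: "converges C X T P Z x l"
    then show "pointed_net C X Q Z (\<lambda>q. x (h q)) l"
      using convD(1)[OF P x] by (auto simp: pointed_net_def cofinal_map_def)
    assume i: "i \<in> I"
    show "converges C (fst (S i)) (snd (S i)) Q Z (\<lambda>q. f i \<cdot> x (h q)) (f i \<cdot> l)"
      using convergence_structure.subnetsD[OF S_cs[OF i] _ P Q h convD(2)[OF P x i]] S_top[OF i]
      by (simp add: net_topology_def)
  qed
  moreover have "locality C X T"
  proof (rule localityI, rule convI)
    fix P :: "'u rel" and R h Z x l i
    assume P: "P \<in> dirsets" and x: "pointed_net C X P Z x l"
      and Rh: "\<And>Q. Q \<in> cofinal_subsets P \<Longrightarrow> R Q \<in> dirsets \<and> cofinal_map (R Q) (Restr P Q) (h Q)"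
      and xh: "\<And>Q. Q \<in> cofinal_subsets P \<Longrightarrow> converges C X T (R Q) Z (\<lambda>r. x (h Q r)) l"
    show "pointed_net C X P Z x l" by (rule x)
    assume i: "i \<in> I"
    have "converges C (fst (S i)) (snd (S i)) (R Q) Z (\<lambda>r. f i \<cdot> x (h Q r)) (f i \<cdot> l)"
      if "Q \<in> cofinal_subsets P" for Q
      using convD(2)[OF _ xh[OF that] i] Rh[OF that] by blast
    then show "converges C (fst (S i)) (snd (S i)) P Z (\<lambda>p. f i \<cdot> x p) (f i \<cdot> l)"
      using convergence_structure.localityD[OF S_cs[OF i] P Rh _ pn[OF i x]] S_top[OF i]
      by (simp add: net_topology_def)
  qed
  moreover have "iterations C X T"
  proof (rule iterationsI, rule convI)
    fix P R :: "'u rel" and Q :: "'u \<Rightarrow> 'u rel" and e Z x y l i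
    assume P: "P \<in> dirsets" and Q: "\<And>p. p \<in> Field P \<Longrightarrow> Q p \<in> dirsets"
      and R: "R \<in> dirsets" and e: "order_iso R (iteration_order P Q) e"
      and x: "\<And>p. p \<in> Field P \<Longrightarrow> converges C X T (Q p) Z (x p) (y p)"
      and y: "converges C X T P Z y l"
    show "R \<in> dirsets" by (rule R)
    have "\<forall>p\<in>Field P. Q p \<in> dirsets"
      using Q by blast
    note er = order_iso_iteration_order[OF P this e]
    show "pointed_net C X R Z (\<lambda>r. case e r of (p, f) \<Rightarrow> x p (f p)) l"
      using er convD(1)[OF Q x] convD(1)[OF P y] by (auto simp: pointed_net_def case_prod_unfold)
    assume i: "i \<in> I"
    have "converges C (fst (S i)) (snd (S i)) R Z
        (\<lambda>r. case e r of (p, g) \<Rightarrow> f i \<cdot> x p (g p)) (f i \<cdot> l)"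
      using convergence_structure.iterationsD[OF S_cs[OF i] P Q _ R e
          convD(2)[OF Q x i] convD(2)[OF P y i]] S_top[OF i]
      by (simp add: net_topology_def)
    then show "converges C (fst (S i)) (snd (S i)) R Z
        (\<lambda>r. f i \<cdot> (case e r of (p, f) \<Rightarrow> x p (f p))) (f i \<cdot> l)"
      by (simp add: case_prod_unfold)
  qed
  ultimately have "(X, T) \<in> top_objects C"
    using X T by (simp add: top_objects_def net_topology_def)
  then show thesis
    using conv by (intro that) auto
qed

end

section \<open>The forgetful functor is topological\<close>

lemma Top_simps:
  "Obj (Top u C) = top_objects C" "Id (Top u C) A = (A, A, Id C (fst A))"
  "(B', D, g) \<cdot>\<^bsub>Top u C\<^esub> (A, B, f) = (A, D, g \<cdot>\<^bsub>C\<^esub> f)"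
  by (simp_all add: Top_def)

lemma hom_Top:
  "hom (Top u C) A B =
    {(A, B, f) | f. A \<in> top_objects C \<and> B \<in> top_objects C \<and> continuous_arr C A B f}"
  by (auto simp: hom_def Top_def)

lemma on_arr_hom_Top:
  "(\<exists>k\<in>hom (Top u C) A B. on_arr forget k = f) \<longleftrightarrow>
    A \<in> top_objects C \<and> B \<in> top_objects C \<and> continuous_arr C A B f"
  by (auto simp: hom_Top forget_def)

lemma on_obj_forget: "on_obj forget A = fst A"
  by (simp add: forget_def)

lemma locally_small_Top:
  fixes u :: "'u itself" and C :: "('o, 'a) cat"
  assumes "locally_small u C"
  shows "locally_small u (Top u C)"
  unfolding locally_small_def Top_simps
proof (intro ballI)
  fix A B :: "'o \<times> ('u rel \<Rightarrow> 'a)"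
  assume "A \<in> top_objects C" "B \<in> top_objects C"
  then have "small u (hom C (fst A) (fst B))"
    using assms by (auto simp: locally_small_def top_objects_def)
  then show "small u (hom (Top u C) A B)"
    by (rule small_inj[of _ _ "\<lambda>(A, B, f). f"])
      (auto simp: hom_Top continuous_arr_def inj_on_def)
qed

context small_complete_category
begin

lemma continuous_id:
  fixes A :: "'o \<times> ('u rel \<Rightarrow> 'a)"
  assumes A: "A \<in> top_objects C"
  shows "continuous_arr C A A (Id C (fst A))"
proof -
  have X: "fst A \<in> Obj C"
    using A by (auto simp: top_objects_def)
  have "converges C (fst A) (snd A) P Z (\<lambda>p. Id C (fst A) \<cdot> x p) (Id C (fst A) \<cdot> l)"
    if x: "converges C (fst A) (snd A) P Z x l" for P :: "'u rel" and Z x l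
  proof -
    have l: "Id C (fst A) \<cdot> l = l" and xp: "\<And>p. p \<in> Field P \<Longrightarrow> x p = Id C (fst A) \<cdot> x p"
      using x comp_id_left by (auto simp: converges_def pointed_net_def)
    from converges_cong[THEN iffD1, OF xp x] show ?thesis
      unfolding l .
  qed
  then show ?thesis
    unfolding continuous_arr_iff[OF A A id_hom[OF X]] by blast
qed

lemma continuous_comp:
  fixes A B D :: "'o \<times> ('u rel \<Rightarrow> 'a)"
  assumes A: "A \<in> top_objects C" and B: "B \<in> top_objects C" and D: "D \<in> top_objects C"
    and f: "continuous_arr C A B f" and g: "continuous_arr C B D g"
  shows "continuous_arr C A D (g \<cdot> f)"
proof -
  have fh: "f \<in> hom C (fst A) (fst B)" and gh: "g \<in> hom C (fst B) (fst D)"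
    using f g by (simp_all add: continuous_arr_def)
  have "converges C (fst D) (snd D) P Z (\<lambda>p. (g \<cdot> f) \<cdot> x p) ((g \<cdot> f) \<cdot> l)"
    if P: "P \<in> dirsets" and x: "converges C (fst A) (snd A) P Z x l" for P :: "'u rel" and Z x l
  proof -
    have l: "g \<cdot> (f \<cdot> l) = (g \<cdot> f) \<cdot> l"
      and xp: "\<And>p. p \<in> Field P \<Longrightarrow> g \<cdot> (f \<cdot> x p) = (g \<cdot> f) \<cdot> x p"
      using x comp_assoc[OF _ fh gh] by (auto simp: converges_def pointed_net_def)
    have "converges C (fst D) (snd D) P Z (\<lambda>p. g \<cdot> (f \<cdot> x p)) (g \<cdot> (f \<cdot> l))"
      using f[unfolded continuous_arr_iff[OF A B fh]] g[unfolded continuous_arr_iff[OF B D gh]] P x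
      by blast
    from converges_cong[THEN iffD1, OF xp this] show ?thesis
      unfolding l .
  qed
  then show ?thesis
    unfolding continuous_arr_iff[OF A D comp_hom[OF fh gh]] by blast
qed

lemma category_Top: "category (Top TYPE('u) C)"
proof
  let ?T = "Top TYPE('u) C"
  have hom: "f \<in> hom C (fst A) (fst B)" if "continuous_arr C A B f" for A B :: "'o \<times> ('u rel \<Rightarrow> 'a)" and f
    using that by (simp add: continuous_arr_def)
  show "Dom ?T f \<in> Obj ?T" "Cod ?T f \<in> Obj ?T" if "f \<in> Arr ?T" for f
    using that by (auto simp: Top_def)
  show "Id ?T A \<in> hom ?T A A" if "A \<in> Obj ?T" for A
    using that continuous_id by (simp add: Top_simps hom_Top)
  show "g \<cdot>\<^bsub>?T\<^esub> f \<in> hom ?T A D" if "f \<in> hom ?T A B" "g \<in> hom ?T B D" for f g A B D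
    using that continuous_comp[of A B D] by (auto simp: Top_simps hom_Top)
  show "Id ?T B \<cdot>\<^bsub>?T\<^esub> f = f" "f \<cdot>\<^bsub>?T\<^esub> Id ?T A = f" if "f \<in> hom ?T A B" for f A B
    using that comp_id_left[OF hom[of A B]] comp_id_right[OF hom[of A B]] by (auto simp: Top_simps hom_Top)
  show "(h \<cdot>\<^bsub>?T\<^esub> g) \<cdot>\<^bsub>?T\<^esub> f = h \<cdot>\<^bsub>?T\<^esub> (g \<cdot>\<^bsub>?T\<^esub> f)"
    if "f \<in> hom ?T A B" "g \<in> hom ?T B D" "h \<in> hom ?T D E" for f g h A B D E
    using that comp_assoc[OF hom[of A B] hom[of B D] hom[of D E]] by (auto simp: Top_simps hom_Top)
qed

lemma functor_forget: "cat_functor (Top TYPE('u) C) C forget"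
proof (intro cat_functor.intro cat_functor_axioms.intro category_Top category_axioms)
  let ?T = "Top TYPE('u) C"
  show "on_obj forget A \<in> Obj C" if "A \<in> Obj ?T" for A
    using that by (auto simp: on_obj_forget Top_simps top_objects_def)
  show "on_arr forget f \<in> hom C (on_obj forget A) (on_obj forget B)" if "f \<in> hom ?T A B" for f A B
    using that by (auto simp: forget_def hom_Top continuous_arr_def)
  show "on_arr forget (Id ?T A) = Id C (on_obj forget A)" if "A \<in> Obj ?T" for A
    by (simp add: forget_def Top_simps)
  show "on_arr forget (g \<cdot>\<^bsub>?T\<^esub> f) = on_arr forget g \<cdot> on_arr forget f"
    if "f \<in> hom ?T A B" "g \<in> hom ?T B D" for f g A B D
    using that by (auto simp: forget_def Top_simps hom_Top)
qed

lemma faithful_forget: "faithful (Top TYPE('u) C) forget"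
  by (auto simp: faithful_def inj_on_def hom_Top forget_def)

text \<open>
  Initiality is immediate from the description of convergence: \<open>h\<close> preserves convergence into the
  initial topology iff all \<open>f i \<cdot> h\<close> preserve convergence.
\<close>

theorem topological_forget:
  assumes wp: "wellpowered TYPE('u) C"
  shows "topological_functor TYPE('i) (Top TYPE('u) C) C forget"
  unfolding topological_functor_def
proof (intro conjI allI impI functor_forget faithful_forget)
  fix I :: "'i set" and X f and S :: "'i \<Rightarrow> 'o \<times> ('u rel \<Rightarrow> 'a)"
  assume "X \<in> Obj C \<and> (\<forall>i\<in>I. S i \<in> Obj (Top TYPE('u) C) \<and> f i \<in> hom C X (on_obj forget (S i)))"
  then have X: "X \<in> Obj C" and S: "\<And>i. i \<in> I \<Longrightarrow> S i \<in> top_objects C"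
    and f: "\<And>i. i \<in> I \<Longrightarrow> f i \<in> hom C X (fst (S i))"
    by (auto simp: Top_simps on_obj_forget)
  obtain T :: "'u rel \<Rightarrow> 'a" where L: "(X, T) \<in> top_objects C"
    and conv: "\<forall>P\<in>dirsets. \<forall>Z x l. pointed_net C X P Z x l \<longrightarrow> (converges C X T P Z x l \<longleftrightarrow>
      (\<forall>i\<in>I. converges C (fst (S i)) (snd (S i)) P Z (\<lambda>p. f i \<cdot> x p) (f i \<cdot> l)))"
    using ex_initial_topology[of X I S f, OF wp X S f] .
  have conv': "converges C X T P Z x l \<longleftrightarrow>
      (\<forall>i\<in>I. converges C (fst (S i)) (snd (S i)) P Z (\<lambda>p. f i \<cdot> x p) (f i \<cdot> l))"
    if "P \<in> dirsets" "pointed_net C X P Z x l" for P Z x l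
    using conv that by blast
  have fL: "f i \<in> hom C (fst (X, T)) (fst (S i))" if "i \<in> I" for i
    using f[OF that] by simp
  have cont_f: "continuous_arr C (X, T) (S i) (f i)" if i: "i \<in> I" for i
    unfolding continuous_arr_iff[OF L S[OF i] fL[OF i]]
    using conv' i by (auto simp: converges_def[of C X T])
  have cont_iff: "continuous_arr C B (X, T) h \<longleftrightarrow> (\<forall>i\<in>I. continuous_arr C B (S i) (f i \<cdot> h))"
    if B: "B \<in> top_objects C" and h: "h \<in> hom C (fst B) X" for B h
  proof
    assume "continuous_arr C B (X, T) h"
    then show "\<forall>i\<in>I. continuous_arr C B (S i) (f i \<cdot> h)"
      using continuous_comp[OF B L S _ cont_f] by blast
  next
    have hL: "h \<in> hom C (fst B) (fst (X, T))"
      using h by simp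
    assume cont: "\<forall>i\<in>I. continuous_arr C B (S i) (f i \<cdot> h)"
    have "converges C X T P Z (\<lambda>p. h \<cdot> x p) (h \<cdot> l)"
      if P: "P \<in> dirsets" and x: "converges C (fst B) (snd B) P Z x l" for P Z x l
    proof -
      have xB: "\<And>p. p \<in> Field P \<Longrightarrow> x p \<in> hom C Z (fst B)" and lB: "l \<in> hom C Z (fst B)"
        using x by (simp_all add: converges_def pointed_net_def)
      have "converges C (fst (S i)) (snd (S i)) P Z (\<lambda>p. f i \<cdot> (h \<cdot> x p)) (f i \<cdot> (h \<cdot> l))"
        if i: "i \<in> I" for i
      proof -
        have "converges C (fst (S i)) (snd (S i)) P Z (\<lambda>p. (f i \<cdot> h) \<cdot> x p) ((f i \<cdot> h) \<cdot> l)"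
          using bspec[OF cont i] P x
          unfolding continuous_arr_iff[OF B S[OF i] comp_hom[OF h f[OF i]]] by blast
        from converges_cong[THEN iffD1, OF comp_assoc[OF xB h f[OF i]] this] show ?thesis
          unfolding comp_assoc[OF lB h f[OF i]] .
      qed
      moreover have "pointed_net C X P Z (\<lambda>p. h \<cdot> x p) (h \<cdot> l)"
        using comp_hom[OF xB h] comp_hom[OF lB h] by (simp add: pointed_net_def)
      ultimately show ?thesis
        using conv'[OF P] by blast
    qed
    then show "continuous_arr C B (X, T) h"
      unfolding continuous_arr_iff[OF B L hL] by simp
  qed
  have "is_initial_lift (Top TYPE('u) C) C forget I X S f (X, T)"
    unfolding is_initial_lift_def on_arr_hom_Top on_obj_forget Top_simps
    using L S cont_f cont_iff by auto
  then show "\<exists>L. is_initial_lift (Top TYPE('u) C) C forget I X S f L" ..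
qed

end


section \<open>Topological functors lift colimits\<close>

text \<open>
  Equip the colimit \<open>L\<close> in \<open>C\<close> with the initial structure for all pairs of an object \<open>B\<close> and an arrow
  \<open>g : L \<rightarrow> U B\<close> such that each \<open>g \<cdot> i j\<close> lifts. The colimit cocone then lifts by
  initiality. For a competing cocone, the arrow induced in \<open>C\<close> is itself a member of the family, so it
  lifts too; by faithfulness commuting diagrams and uniqueness are inherited from \<open>C\<close>. The pairs
  dictate the index type \<open>'o1 \<times> 'a2\<close>.
\<close>

theorem topological_functor_lifts_colimits:
  fixes A :: "('o1, 'a1) cat" and C :: "('o2, 'a2) cat" and D :: "('j, 'b, 'o1, 'a1) cat_map"
  assumes top: "topological_functor TYPE('o1 \<times> 'a2) A C U"
    and D: "cat_functor J A D"
    and colim: "is_colimit J C \<lparr>on_obj = \<lambda>j. on_obj U (on_obj D j), on_arr = \<lambda>u. on_arr U (on_arr D u)\<rparr> L i"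
  shows "\<exists>M k. is_colimit J A D M k"
proof -
  interpret U: cat_functor A C U
    using top by (simp add: topological_functor_def)
  interpret D: cat_functor J A D
    by (rule D)
  let ?UD = "\<lparr>on_obj = \<lambda>j. on_obj U (on_obj D j), on_arr = \<lambda>u. on_arr U (on_arr D u)\<rparr>"
  have faithful: "k = k'" if "k \<in> hom A X Y" "k' \<in> hom A X Y" "on_arr U k = on_arr U k'" for k k' X Y
    using top that U.A.homD(4,5)[OF that(1)]
    by (auto simp: topological_functor_def faithful_def dest: inj_onD)
  have L: "L \<in> Obj C" and i: "\<And>j. j \<in> Obj J \<Longrightarrow> i j \<in> hom C (on_obj U (on_obj D j)) L"
    and i_nat: "\<And>u. u \<in> Arr J \<Longrightarrow> i (Cod J u) \<cdot>\<^bsub>C\<^esub> on_arr U (on_arr D u) = i (Dom J u)"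
    using colim by (simp_all add: is_colimit_def is_cocone_def)
  have univ: "\<exists>!h. h \<in> hom C L Z \<and> (\<forall>j\<in>Obj J. h \<cdot>\<^bsub>C\<^esub> i j = q j)" if "is_cocone J C ?UD Z q" for Z q
    using colim that unfolding is_colimit_def by blast
  define I where "I = {(B, g). B \<in> Obj A \<and> g \<in> hom C L (on_obj U B) \<and>
    (\<forall>j\<in>Obj J. \<exists>k\<in>hom A (on_obj D j) B. on_arr U k = g \<cdot>\<^bsub>C\<^esub> i j)}"
  have "\<exists>M. is_initial_lift A C U I L fst snd M"
    using top L unfolding topological_functor_def by (auto simp: I_def)
  then obtain M where M: "M \<in> Obj A" "on_obj U M = L"
    and lift: "\<forall>b\<in>I. \<exists>k\<in>hom A M (fst b). on_arr U k = snd b"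
    and init: "\<forall>B\<in>Obj A. \<forall>h\<in>hom C (on_obj U B) L.
      (\<exists>k\<in>hom A B M. on_arr U k = h) \<longleftrightarrow>
      (\<forall>b\<in>I. \<exists>k\<in>hom A B (fst b). on_arr U k = snd b \<cdot>\<^bsub>C\<^esub> h)"
    unfolding is_initial_lift_def by (elim exE conjE) (rule that)
  have "\<exists>k. k \<in> hom A (on_obj D j) M \<and> on_arr U k = i j" if j: "j \<in> Obj J" for j
  proof -
    have "\<forall>b\<in>I. \<exists>k\<in>hom A (on_obj D j) (fst b). on_arr U k = snd b \<cdot>\<^bsub>C\<^esub> i j"
      using j by (auto simp: I_def)
    then show ?thesis
      using bspec[OF bspec[OF init D.on_obj[OF j]] i[OF j]] by blast
  qed
  then obtain k where k: "\<And>j. j \<in> Obj J \<Longrightarrow> k j \<in> hom A (on_obj D j) M"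
    "\<And>j. j \<in> Obj J \<Longrightarrow> on_arr U (k j) = i j"
    by metis
  have "is_cocone J A D M k"
    unfolding is_cocone_def
  proof (intro conjI ballI M(1) k(1))
    fix u assume u: "u \<in> Arr J"
    note Du = D.on_arr[OF D.A.arr_hom[OF u]]
    note kc = k[OF D.A.cod_obj[OF u]] and kd = k[OF D.A.dom_obj[OF u]]
    show "k (Cod J u) \<cdot>\<^bsub>A\<^esub> on_arr D u = k (Dom J u)"
      by (rule faithful[OF U.A.comp_hom[OF Du kc(1)] kd(1)])
        (simp add: U.on_comp[OF Du kc(1)] kc(2) kd(2) i_nat[OF u])
  qed
  moreover have "\<exists>!h. h \<in> hom A M Z \<and> (\<forall>j\<in>Obj J. h \<cdot>\<^bsub>A\<^esub> k j = q j)" if q: "is_cocone J A D Z q" for Z q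
  proof -
    have Z: "Z \<in> Obj A" and q_hom: "\<And>j. j \<in> Obj J \<Longrightarrow> q j \<in> hom A (on_obj D j) Z"
      and q_nat: "\<And>u. u \<in> Arr J \<Longrightarrow> q (Cod J u) \<cdot>\<^bsub>A\<^esub> on_arr D u = q (Dom J u)"
      using q by (simp_all add: is_cocone_def)
    have "on_arr U (q (Cod J u)) \<cdot>\<^bsub>C\<^esub> on_arr U (on_arr D u) = on_arr U (q (Dom J u))"
      if u: "u \<in> Arr J" for u
      using U.on_comp[OF D.on_arr[OF D.A.arr_hom[OF u]] q_hom[OF D.A.cod_obj[OF u]]] q_nat[OF u]
      by simp
    then have "is_cocone J C ?UD (on_obj U Z) (\<lambda>j. on_arr U (q j))"
      using U.on_obj[OF Z] U.on_arr[OF q_hom] by (simp add: is_cocone_def)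
    from univ[OF this] obtain h where h: "h \<in> hom C L (on_obj U Z)"
      "\<And>j. j \<in> Obj J \<Longrightarrow> h \<cdot>\<^bsub>C\<^esub> i j = on_arr U (q j)"
      and h_unique: "\<And>h'. h' \<in> hom C L (on_obj U Z) \<Longrightarrow>
        (\<forall>j\<in>Obj J. h' \<cdot>\<^bsub>C\<^esub> i j = on_arr U (q j)) \<Longrightarrow> h' = h"
      by (elim ex1E) blast
    have "(Z, h) \<in> I"
      using Z h q_hom by (auto simp: I_def)
    then obtain g where g: "g \<in> hom A M Z" "on_arr U g = h"
      using bspec[OF lift, of "(Z, h)"] by auto
    have "g \<cdot>\<^bsub>A\<^esub> k j = q j" if j: "j \<in> Obj J" for j
      by (rule faithful[OF U.A.comp_hom[OF k(1)[OF j] g(1)] q_hom[OF j]])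
        (simp add: U.on_comp[OF k(1)[OF j] g(1)] k(2)[OF j] g(2) h(2)[OF j])
    moreover have "g' = g" if g': "g' \<in> hom A M Z" "\<forall>j\<in>Obj J. g' \<cdot>\<^bsub>A\<^esub> k j = q j" for g'
    proof (rule faithful[OF g'(1) g(1)])
      have "on_arr U g' \<cdot>\<^bsub>C\<^esub> i j = on_arr U (q j)" if j: "j \<in> Obj J" for j
        using U.on_comp[OF k(1)[OF j] g'(1)] k(2)[OF j] bspec[OF g'(2) j] by simp
      then show "on_arr U g' = on_arr U g"
        using h_unique[of "on_arr U g'"] U.on_arr[OF g'(1)] M(2) g(2) by simp
    qed
    ultimately show ?thesis
      using g(1) by blast
  qed
  ultimately have "is_colimit J A D M k"
    by (simp add: is_colimit_def)
  then show ?thesis by blast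
qed

lemma topological_functor_cocomplete:
  fixes A :: "('o1, 'a1) cat" and C :: "('o2, 'a2) cat" and u :: "'u itself"
  assumes top: "topological_functor TYPE('o1 \<times> 'a2) A C U"
    and C: "cocomplete_cat u C"
  shows "cocomplete_cat u A"
  unfolding cocomplete_cat_def
proof (intro allI impI, elim conjE)
  fix J :: "('u, 'u) cat" and D
  assume J: "small u (Obj J)" "small u (Arr J)" and D: "cat_functor J A D"
  interpret U: cat_functor A C U
    using top by (simp add: topological_functor_def)
  interpret D: cat_functor J A D
    by (rule D)
  let ?UD = "\<lparr>on_obj = \<lambda>j. on_obj U (on_obj D j), on_arr = \<lambda>u. on_arr U (on_arr D u)\<rparr>"
  have "cat_functor J C ?UD"
    by unfold_locales
      (simp_all add: D.on_obj U.on_obj D.on_id U.on_id D.on_arr[THEN U.on_arr]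
        D.on_comp U.on_comp[OF D.on_arr D.on_arr])
  then obtain L i where "is_colimit J C ?UD L i"
    using C J unfolding cocomplete_cat_def by blast
  from topological_functor_lifts_colimits[OF top D this] show "\<exists>M k. is_colimit J A D M k" .
qed


theorem proposition1p5:
  fixes C :: "('o, 'a) cat"
  assumes "universe TYPE('u)"
    and "category C" and "locally_small TYPE('u) C"
    and "wellpowered TYPE('u) C" and "complete_cat TYPE('u) C"
  shows "locally_small TYPE('u) (Top TYPE('u) C) \<and>
    topological_functor TYPE('i) (Top TYPE('u) C) C forget \<and>
    (cocomplete_cat TYPE('u) C \<longrightarrow> cocomplete_cat TYPE('u) (Top TYPE('u) C))"
proof -
  interpret small_complete_category C "TYPE('u)"
    using assms(1,2,5) by (intro small_complete_category.intro small_complete_category_axioms.intro)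
  show ?thesis
    using locally_small_Top[OF assms(3)] topological_forget[OF assms(4)]
      topological_functor_cocomplete[OF topological_forget[OF assms(4)]] by blast
qed

end
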